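(* The language preservation problem is undecidable for L/U-PTA with at least one lower-bound parameter and at least one upper-bound parameter.
   Context: Clocks are real-valued; parameters take nonnegative rational values. Atomic constraints: $x\sim p+c$, $x\sim c$, $p\sim c$ ($\sim\in\{<,\le,=,\ge,>\}$, $c\in\mathbb Z$); constraints are conjunctions. A PTA $(\Sigma,L,\ell_0,X,P,I,E)$ has invariants $I(\ell)$ and edges $(\ell,g,a,R,\ell')$. An L/U-PTA is a PTA whose parameter set is partitioned into lower-bound parameters, which only appear in clock constraints as lower bounds on clocks (e.g. $x\ge p+c$, $x>p+c$), and upper-bound parameters, which only appear as upper bounds (e.g. $x\le p+c$, $x<p+c$). For parameter valuation $v$, $v(\mathcal A)$ is the timed automaton obtained by substituting parameter values, with steps for delay $d\ge0$ when $w+d$ satisfies the guard and $w'=(w+d)[R\mapsto0]$ (configurations satisfy invariants). A run is a maximal step sequence from $(\ell_0,\mathbf 0)$; $\mathcal L(v(\mathcal A))$ is the set of action sequences of runs. Language preservation problem: given $\mathcal A$ and $v$, decide whether some $v'\ne v$ satisfies $\mathcal L(v'(\mathcal A))=\mathcal L(v(\mathcal A))$. *)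

theory Defs
  imports Complex_Main "HOL-Library.Nat_Bijection"
begin

section \<open>Parametric timed automata\<close>

datatype cmp = LT | LE | EQ | GE | GT

fun cmp_holds :: "cmp \<Rightarrow> real \<Rightarrow> real \<Rightarrow> bool" where
  "cmp_holds LT a b = (a < b)"
| "cmp_holds LE a b = (a \<le> b)"
| "cmp_holds EQ a b = (a = b)"
| "cmp_holds GE a b = (a \<ge> b)"
| "cmp_holds GT a b = (a > b)"

text \<open>
  Automata are inputs of a decision problem, hence finite objects: actions, locations, clocks and
  parameters are named by natural numbers, and a list stands for the finite set of its elements
  (for a constraint: the conjunction of its elements).
\<close>

datatype atom =
    Clk_Par nat cmp nat int  \<comment> \<open>\<open>x \<sim> p + c\<close>\<close>
  | Clk_Const nat cmp int    \<comment> \<open>\<open>x \<sim> c\<close>\<close>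
  | Par_Const nat cmp int    \<comment> \<open>\<open>p \<sim> c\<close>\<close>

type_synonym constr = "atom list"

text \<open>An edge is \<open>(source, guard, action, reset clocks, target)\<close>.\<close>

type_synonym edge = "nat \<times> constr \<times> nat \<times> nat list \<times> nat"

record pta =
  acts :: "nat list"
  locs :: "nat list"
  init :: nat
  clocks :: "nat list"
  params :: "nat list"
  inv_of :: "nat \<Rightarrow> constr"  \<comment> \<open>only its values on \<^term>\<open>locs\<close> matter\<close>
  edges :: "edge list"

fun wf_atom :: "nat set \<Rightarrow> nat set \<Rightarrow> atom \<Rightarrow> bool" where
  "wf_atom X P (Clk_Par x r p c) = (x \<in> X \<and> p \<in> P)"
| "wf_atom X P (Clk_Const x r c) = (x \<in> X)"
| "wf_atom X P (Par_Const p r c) = (p \<in> P)"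

definition wf_constr :: "pta \<Rightarrow> constr \<Rightarrow> bool" where
  "wf_constr A C \<longleftrightarrow> (\<forall>a\<in>set C. wf_atom (set (clocks A)) (set (params A)) a)"

definition wf_pta :: "pta \<Rightarrow> bool" where
  "wf_pta A \<longleftrightarrow>
     init A \<in> set (locs A) \<and>
     (\<forall>l\<in>set (locs A). wf_constr A (inv_of A l)) \<and>
     (\<forall>(l, g, a, R, l')\<in>set (edges A).
        l \<in> set (locs A) \<and> wf_constr A g \<and> a \<in> set (acts A) \<and>
        set R \<subseteq> set (clocks A) \<and> l' \<in> set (locs A))"

text \<open>The constraints occurring in an automaton: its invariants and its guards.\<close>

definition constrs :: "pta \<Rightarrow> constr set" where
  "constrs A = inv_of A ` set (locs A) \<union> {g. \<exists>l a R l'. (l, g, a, R, l') \<in> set (edges A)}"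

text \<open>
  Lower-bound parameters occur only as lower bounds on clocks, and upper-bound parameters only as
  upper bounds on clocks; in particular no parameter occurs in an atom \<open>p \<sim> c\<close> or \<open>x = p + c\<close>.
\<close>

fun lu_atom :: "nat set \<Rightarrow> nat set \<Rightarrow> atom \<Rightarrow> bool" where
  "lu_atom Lo Up (Clk_Par x r p c) =
     ((p \<in> Lo \<longrightarrow> r \<in> {GE, GT}) \<and> (p \<in> Up \<longrightarrow> r \<in> {LE, LT}))"
| "lu_atom Lo Up (Clk_Const x r c) = True"
| "lu_atom Lo Up (Par_Const p r c) = (p \<notin> Lo \<union> Up)"

definition lu_partition :: "pta \<Rightarrow> nat set \<Rightarrow> nat set \<Rightarrow> bool" where
  "lu_partition A Lo Up \<longleftrightarrow>
     Lo \<union> Up = set (params A) \<and> Lo \<inter> Up = {} \<and>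
     (\<forall>C\<in>constrs A. \<forall>a\<in>set C. lu_atom Lo Up a)"

section \<open>Semantics and language\<close>

type_synonym pval = "nat \<Rightarrow> rat"
type_synonym cval = "nat \<Rightarrow> real"

definition valuation :: "pta \<Rightarrow> pval \<Rightarrow> bool" where
  "valuation A v \<longleftrightarrow> (\<forall>p\<in>set (params A). v p \<ge> 0)"

text \<open>
  Satisfaction by a clock valuation \<open>w\<close> of a constraint in which every parameter \<open>p\<close> has been
  replaced by \<open>v p\<close>. All notions below taking \<open>A\<close> and \<open>v\<close> are those of the timed automaton \<open>v(A)\<close>.
\<close>

fun sat_atom :: "pval \<Rightarrow> cval \<Rightarrow> atom \<Rightarrow> bool" where
  "sat_atom v w (Clk_Par x r p c) = cmp_holds r (w x) (real_of_rat (v p) + real_of_int c)"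
| "sat_atom v w (Clk_Const x r c) = cmp_holds r (w x) (real_of_int c)"
| "sat_atom v w (Par_Const p r c) = cmp_holds r (real_of_rat (v p)) (real_of_int c)"

definition sat :: "pval \<Rightarrow> cval \<Rightarrow> constr \<Rightarrow> bool" where
  "sat v w C \<longleftrightarrow> (\<forall>a\<in>set C. sat_atom v w a)"

definition delay :: "cval \<Rightarrow> real \<Rightarrow> cval" where
  "delay w d = (\<lambda>x. w x + d)"

definition reset :: "nat set \<Rightarrow> cval \<Rightarrow> cval" where
  "reset R w = (\<lambda>x. if x \<in> R then 0 else w x)"

type_synonym config = "nat \<times> cval"

definition is_config :: "pta \<Rightarrow> pval \<Rightarrow> config \<Rightarrow> bool" where
  "is_config A v = (\<lambda>(l, w). l \<in> set (locs A) \<and> sat v w (inv_of A l))"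

text \<open>
  A step lets time elapse and then fires an edge. All configurations traversed satisfy the
  invariant, including those met while time elapses.
\<close>

inductive step :: "pta \<Rightarrow> pval \<Rightarrow> config \<Rightarrow> nat \<Rightarrow> config \<Rightarrow> bool" for A v where
  "\<lbrakk>(l, g, a, R, l') \<in> set (edges A); d \<ge> 0;
    \<And>t. 0 \<le> t \<Longrightarrow> t \<le> d \<Longrightarrow> is_config A v (l, delay w t);
    sat v (delay w d) g;
    w' = reset (set R) (delay w d);
    is_config A v (l', w')\<rbrakk>
   \<Longrightarrow> step A v (l, w) a (l', w')"

definition init_config :: "pta \<Rightarrow> config" where
  "init_config A = (init A, \<lambda>_. 0)"

datatype word = Fin "nat list" | Inf "nat \<Rightarrow> nat"

text \<open>
  The words of the finite maximal runs (those ending in a configuration without outgoing step)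
  and of the infinite runs. There is no run if the initial configuration violates its invariant.
\<close>

definition language :: "pta \<Rightarrow> pval \<Rightarrow> word set" where
  "language A v =
     {Fin u | u. \<exists>\<rho> :: nat \<Rightarrow> config.
        \<rho> 0 = init_config A \<and> is_config A v (\<rho> 0) \<and>
        (\<forall>i < length u. step A v (\<rho> i) (u ! i) (\<rho> (Suc i))) \<and>
        (\<nexists>a s. step A v (\<rho> (length u)) a s)} \<union>
     {Inf u | u. \<exists>\<rho> :: nat \<Rightarrow> config.
        \<rho> 0 = init_config A \<and> is_config A v (\<rho> 0) \<and>
        (\<forall>i. step A v (\<rho> i) (u i) (\<rho> (Suc i)))}"

definition language_preserved :: "pta \<Rightarrow> pval \<Rightarrow> bool" where
  "language_preserved A v \<longleftrightarrow>
     (\<exists>v'. valuation A v' \<and> (\<exists>p\<in>set (params A). v' p \<noteq> v p) \<and>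
           language A v' = language A v)"

section \<open>Decidability\<close>

text \<open>Terms for the partial recursive functions, and their graphs.\<close>

datatype recf =
    Zero
  | Succ
  | Proj nat
  | Comp recf "recf list"
  | Prim_Rec recf recf
  | Mu recf

inductive computes :: "recf \<Rightarrow> nat list \<Rightarrow> nat \<Rightarrow> bool" where
  zero: "computes Zero xs 0"
| succ: "computes Succ [x] (Suc x)"
| proj: "i < length xs \<Longrightarrow> computes (Proj i) xs (xs ! i)"
| comp: "\<lbrakk>list_all2 (\<lambda>g y. computes g xs y) gs ys; computes f ys z\<rbrakk>
         \<Longrightarrow> computes (Comp f gs) xs z"
| prim_rec_0: "computes f xs y \<Longrightarrow> computes (Prim_Rec f g) (0 # xs) y"
| prim_rec_Suc: "\<lbrakk>computes (Prim_Rec f g) (n # xs) r; computes g (n # r # xs) y\<rbrakk>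
         \<Longrightarrow> computes (Prim_Rec f g) (Suc n # xs) y"
| mu: "\<lbrakk>computes f (n # xs) 0; \<forall>m<n. \<exists>k. computes f (m # xs) (Suc k)\<rbrakk>
         \<Longrightarrow> computes (Mu f) xs n"

inductive_cases computes_elims:
  "computes Zero xs y" "computes Succ xs y" "computes (Proj i) xs y"
  "computes (Comp f gs) xs y" "computes (Prim_Rec f g) (0 # xs) y"
  "computes (Prim_Rec f g) (Suc n # xs) y" "computes (Mu f) xs y"

lemma computes_functional: "computes f xs y \<Longrightarrow> computes f xs z \<Longrightarrow> y = z"
proof (induction arbitrary: z rule: computes.induct)
  case (zero xs)
  then show ?case by (rule computes_elims(1)) simp
next
  case (succ x)
  then show ?case by (rule computes_elims(2)) simp
next
  case (proj i xs)
  from proj(2) show ?case by (rule computes_elims(3)) simp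
next
  case (comp xs gs ys f y)
  from comp.prems obtain ys' where
    ys': "list_all2 (\<lambda>g y. computes g xs y) gs ys'" and z: "computes f ys' z"
    by (rule computes_elims(4))
  have "ys = ys'"
  proof (rule nth_equalityI)
    show "length ys = length ys'"
      using list_all2_lengthD[OF comp.IH(1)] list_all2_lengthD[OF ys'] by simp
    show "ys ! i = ys' ! i" if "i < length ys" for i
      using list_all2_nthD2[OF comp.IH(1) that] list_all2_nthD[OF ys', of i]
        list_all2_lengthD[OF comp.IH(1)] that by simp
  qed
  with comp.IH(2) z show ?case by blast
next
  case (prim_rec_0 f xs y g)
  from prim_rec_0.prems have "computes f xs z" by (rule computes_elims(5))
  then show ?case by (rule prim_rec_0.IH)
next
  case (prim_rec_Suc f g n xs r y)
  from prim_rec_Suc.prems obtain r' where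
    r': "computes (Prim_Rec f g) (n # xs) r'" "computes g (n # r' # xs) z"
    by (rule computes_elims(6))
  from prim_rec_Suc.IH(1)[OF r'(1)] r'(2) have "computes g (n # r # xs) z" by simp
  then show ?case by (rule prim_rec_Suc.IH(2))
next
  case (mu f n xs)
  from mu.prems have z: "computes f (z # xs) 0 \<and> (\<forall>m<z. \<exists>k. computes f (m # xs) (Suc k))"
    by (rule computes_elims(7)) blast
  show ?case
  proof (rule linorder_cases[of n z])
    assume "n < z"
    with z obtain k where "computes f (n # xs) (Suc k)" by blast
    from mu.IH(1)[OF this] show ?thesis by simp
  next
    assume "z < n"
    with mu.IH(2) z show ?thesis by blast
  qed
qed

text \<open>
  A decision problem is given by its instances \<open>I\<close>, their coding as natural numbers, and its
  yes-instances \<open>Q\<close>. Nothing is required of the algorithm on numbers that code no instance.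
\<close>

definition decidable :: "('i \<Rightarrow> nat) \<Rightarrow> 'i set \<Rightarrow> 'i set \<Rightarrow> bool" where
  "decidable code I Q \<longleftrightarrow>
     (\<exists>f. \<forall>i\<in>I. computes f [code i] (if i \<in> Q then 1 else 0))"

section \<open>Coding of instances\<close>

fun cmp_code :: "cmp \<Rightarrow> nat" where
  "cmp_code LT = 0"
| "cmp_code LE = 1"
| "cmp_code EQ = 2"
| "cmp_code GE = 3"
| "cmp_code GT = 4"

fun atom_code :: "atom \<Rightarrow> nat" where
  "atom_code (Clk_Par x r p c) = list_encode [0, x, cmp_code r, p, int_encode c]"
| "atom_code (Clk_Const x r c) = list_encode [1, x, cmp_code r, int_encode c]"
| "atom_code (Par_Const p r c) = list_encode [2, p, cmp_code r, int_encode c]"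

definition constr_code :: "constr \<Rightarrow> nat" where
  "constr_code C = list_encode (map atom_code C)"

fun edge_code :: "edge \<Rightarrow> nat" where
  "edge_code (l, g, a, R, l') = list_encode [l, constr_code g, a, list_encode R, l']"

definition pta_code :: "pta \<Rightarrow> nat" where
  "pta_code A = list_encode
     [list_encode (acts A), list_encode (locs A), init A,
      list_encode (clocks A), list_encode (params A),
      list_encode (map (\<lambda>l. constr_code (inv_of A l)) (locs A)),
      list_encode (map edge_code (edges A))]"

definition rat_code :: "rat \<Rightarrow> nat" where
  "rat_code q = prod_encode (map_prod int_encode int_encode (quotient_of q))"

definition instance_code :: "pta \<times> pval \<Rightarrow> nat" where
  "instance_code = (\<lambda>(A, v).
     prod_encode (pta_code A, list_encode (map (\<lambda>p. rat_code (v p)) (params A))))"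

text \<open>The code determines everything about an instance that matters.\<close>

lemma cmp_code_inject: "cmp_code r = cmp_code s \<longleftrightarrow> r = s"
  by (cases r; cases s) simp_all

lemma inj_atom_code: "inj atom_code"
proof (rule injI)
  fix a b assume "atom_code a = atom_code b"
  then show "a = b"
    by (cases a; cases b)
       (auto simp del: list_encode.simps simp: list_encode_eq cmp_code_inject int_encode_eq)
qed

lemma inj_constr_code: "inj constr_code"
  by (rule injI) (simp add: constr_code_def list_encode_eq inj_map_eq_map[OF inj_atom_code])

lemma inj_edge_code: "inj edge_code"
proof (rule injI)
  fix e f assume "edge_code e = edge_code f"
  then show "e = f"
    by (cases e; cases f)
       (auto simp del: list_encode.simps simp: list_encode_eq inj_eq[OF inj_constr_code])
qed

lemma rat_code_inject: "rat_code q = rat_code r \<longleftrightarrow> q = r"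
  unfolding rat_code_def
  by (metis Pair_inject int_encode_eq map_prod_simp prod_encode_eq quotient_of_inject surj_pair)

lemma instance_code_eqD:
  assumes "instance_code (A, v) = instance_code (B, v')"
  shows "acts A = acts B" "locs A = locs B" "init A = init B" "clocks A = clocks B"
    "params A = params B" "edges A = edges B"
    "\<forall>l\<in>set (locs A). inv_of A l = inv_of B l" "\<forall>p\<in>set (params A). v p = v' p"
  using assms
  by (auto simp del: list_encode.simps
        simp: instance_code_def pta_code_def list_encode_eq prod_encode_eq
          inj_map_eq_map[OF inj_edge_code] inj_eq[OF inj_constr_code] rat_code_inject)

section \<open>The problem\<close>

definition lu_instances :: "(pta \<times> pval) set" where
  "lu_instances = {(A, v). wf_pta A \<and> valuation A v \<and>
     (\<exists>Lo Up. lu_partition A Lo Up \<and> Lo \<noteq> {} \<and> Up \<noteq> {})}"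

end

theory Submission
  imports Defs
begin

text \<open>
  The reference valuation maps both parameters to \<open>0\<close>; a guard \<open>x \<ge> p\<^sub>l, x \<le> 0\<close> then gives access to
  an infinite loop, so that the language consists of the infinite word and all nonempty finite words
  over the letter \<open>0\<close>. Valuations with \<open>p\<^sub>l < p\<^sub>u\<close> produce the letter \<open>1\<close>, and all others with
  \<open>p\<^sub>l > 0\<close> can produce the infinite word only by faithfully simulating a counter program, for which
  \<open>p\<^sub>l = p\<^sub>u = p\<close> is necessary. Counters are encoded as clock values modulo cycles of length \<open>p\<close>, so
  a halting run is simulated completely as soon as \<open>p\<close> is large enough, and the infinite word is
  produced iff the program ends with \<open>0\<close> in its output counter. Finite words come from a dead end
  that can be entered at any time, which makes blocked simulations invisible.

  A decision procedure, compiled to a counter program and applied to the code of the automaton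
  that simulates this very program, would refute itself. The program learns the code of its
  automaton from integer constants in the guards of its first three instructions.
\<close>

section \<open>Compiling recursive functions to loop programs\<close>

type_synonym store = "nat \<Rightarrow> nat"

datatype com = Upd nat int | Seq com com (infixr ";;" 60) | Loop nat com

inductive bigstep :: "com \<Rightarrow> store \<Rightarrow> store \<Rightarrow> bool" where
  Upd: "0 \<le> int (s j) + d \<Longrightarrow> bigstep (Upd j d) s (s(j := nat (int (s j) + d)))"
| Seq: "bigstep c s s' \<Longrightarrow> bigstep c' s' s'' \<Longrightarrow> bigstep (c ;; c') s s''"
| Loop_exit: "s j = 0 \<Longrightarrow> bigstep (Loop j c) s s"
| Loop_iter: "s j \<noteq> 0 \<Longrightarrow> bigstep c s s' \<Longrightarrow> bigstep (Loop j c) s' s'' \<Longrightarrow> bigstep (Loop j c) s s''"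

abbreviation skip :: com where "skip \<equiv> Upd 0 0"
abbreviation inc :: "nat \<Rightarrow> com" where "inc j \<equiv> Upd j 1"
abbreviation dec :: "nat \<Rightarrow> com" where "dec j \<equiv> Upd j (-1)"
definition clear :: "nat \<Rightarrow> com" where "clear r = Loop r (dec r)"
definition move :: "nat \<Rightarrow> nat \<Rightarrow> com" where "move r out = Loop r (dec r ;; inc out)"
text \<open>Counting \<open>r\<close> down destroys it; the scratch register \<open>b\<close>
  records the value so that \<open>r\<close> can be restored.\<close>

definition copy :: "nat \<Rightarrow> nat \<Rightarrow> nat \<Rightarrow> com" where
  "copy r out b = Loop r (dec r ;; inc out ;; inc b) ;; move b r"

lemma bigstep_skip: "bigstep skip s s"
  using bigstep.Upd[of s 0 0] by simp

lemma bigstep_inc: "s' = s(j := Suc (s j)) \<Longrightarrow> bigstep (inc j) s s'"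
  using bigstep.Upd[of s j 1] by (simp add: nat_add_distrib)

lemma bigstep_dec: "s j = Suc n \<Longrightarrow> s' = s(j := n) \<Longrightarrow> bigstep (dec j) s s'"
  using bigstep.Upd[of s j "-1"] by simp

lemma bigstep_clear: "bigstep (clear r) s (s(r := 0))"
proof (induction "s r" arbitrary: s)
  case 0
  then have "s(r := 0) = s" by auto
  with 0 show ?case unfolding clear_def by (metis bigstep.Loop_exit)
next
  case (Suc n)
  have 1: "bigstep (dec r) s (s(r := n))" by (rule bigstep_dec) (use Suc(2) in auto)
  have 2: "bigstep (clear r) (s(r := n)) (s(r := 0))" using Suc(1)[of "s(r := n)"] by simp
  show ?case unfolding clear_def
    by (rule bigstep.Loop_iter[OF _ 1 2[unfolded clear_def]]) (use Suc(2) in simp)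
qed

lemma bigstep_move:
  assumes "r \<noteq> out"
  shows "bigstep (move r out) s (s(out := s out + s r, r := 0))"
proof (induction "s r" arbitrary: s)
  case 0
  then have "s(out := s out + s r, r := 0) = s" by auto
  with 0 show ?case unfolding move_def by (metis bigstep.Loop_exit)
next
  case (Suc n)
  let ?s = "s(r := n, out := Suc (s out))"
  have 1: "bigstep (dec r ;; inc out) s ?s"
    by (rule bigstep.Seq[OF bigstep_dec[of _ _ n] bigstep_inc]) (use Suc(2) assms in auto)
  have 2: "bigstep (move r out) ?s (s(out := s out + s r, r := 0))"
    using Suc(1)[of ?s] Suc(2)[symmetric] assms by (simp add: fun_upd_twist)
  show ?case unfolding move_def
    by (rule bigstep.Loop_iter[OF _ 1 2[unfolded move_def]]) (use Suc(2) in simp)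
qed

lemma bigstep_copy:
  assumes "distinct [r, out, b]" "s b = 0"
  shows "bigstep (copy r out b) s (s(out := s out + s r))"
proof -
  have "bigstep (Loop r (dec r ;; inc out ;; inc b)) s
          (s(out := s out + s r, b := s b + s r, r := 0))" for s
  proof (induction "s r" arbitrary: s)
    case 0
    then have "s(out := s out + s r, b := s b + s r, r := 0) = s" by auto
    with 0 show ?case by (metis bigstep.Loop_exit)
  next
    case (Suc n)
    let ?s = "s(r := n, out := Suc (s out), b := Suc (s b))"
    have 1: "bigstep (dec r ;; inc out ;; inc b) s ?s"
      by (rule bigstep.Seq[OF bigstep_dec[of _ _ n] bigstep.Seq[OF bigstep_inc bigstep_inc]])
        (use Suc(2) assms in auto)
    have 2: "bigstep (Loop r (dec r ;; inc out ;; inc b)) ?s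
        (s(out := s out + s r, b := s b + s r, r := 0))"
      using Suc(1)[of ?s] Suc(2)[symmetric] assms by (simp add: fun_upd_twist)
    show ?case by (rule bigstep.Loop_iter[OF _ 1 2]) (use Suc(2) in simp)
  qed
  note 1 = this[of s]
  let ?s = "s(out := s out + s r, b := s b + s r, r := 0)"
  have "bigstep (move b r) ?s (?s(r := ?s r + ?s b, b := 0))"
    by (rule bigstep_move) (use assms in auto)
  moreover have "?s(r := ?s r + ?s b, b := 0) = s(out := s out + s r)"
    using assms by auto
  ultimately show ?thesis using 1 unfolding copy_def by (auto intro: bigstep.Seq)
qed

fun clears :: "nat \<Rightarrow> nat \<Rightarrow> com" where
  "clears b 0 = skip"
| "clears b (Suc m) = clear (b + m) ;; clears b m"

lemma bigstep_clears: "bigstep (clears b m) s (\<lambda>r. if b \<le> r \<and> r < b + m then 0 else s r)"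
proof (induction m arbitrary: s)
  case 0
  have "(\<lambda>r. if b \<le> r \<and> r < b + 0 then 0 else s r) = s" by auto
  then show ?case using bigstep_skip by simp
next
  case (Suc m)
  have "(\<lambda>r. if b \<le> r \<and> r < b + m then 0 else (s(b + m := 0)) r)
      = (\<lambda>r. if b \<le> r \<and> r < b + Suc m then 0 else s r)" by (auto simp: fun_eq_iff)
  then show ?case using bigstep.Seq[OF bigstep_clear Suc, of "b + m" s] by simp
qed

text \<open>
  \<open>compile f rs out b\<close> reads its arguments from the registers \<open>rs\<close>, writes its result to \<open>out\<close> and
  uses the registers from \<open>b\<close> on as scratch space, which it finds and leaves zeroed.
\<close>

fun compile :: "recf \<Rightarrow> nat list \<Rightarrow> nat \<Rightarrow> nat \<Rightarrow> com"
  and compiles :: "recf list \<Rightarrow> nat list \<Rightarrow> nat \<Rightarrow> nat \<Rightarrow> com" where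
  "compile Zero rs out b = skip"
| "compile Succ rs out b = copy (hd rs) out b ;; inc out"
| "compile (Proj i) rs out b = copy (rs ! i) out b"
| "compile (Comp f gs) rs out b =
     compiles gs rs b (b + length gs) ;;
     compile f [b..<b + length gs] out (b + length gs) ;; clears b (length gs)"
| "compile (Prim_Rec f g) rs out b =
     copy (hd rs) (b + 1) b ;; compile f (tl rs) out (b + 2) ;;
     Loop (b + 1) (compile g (b # out # tl rs) (b + 2) (b + 3) ;;
       clear out ;; move (b + 2) out ;; inc b ;; dec (b + 1)) ;;
     clear b"
| "compile (Mu f) rs out b =
     compile f (out # rs) b (b + 1) ;;
     Loop b (clear b ;; inc out ;; compile f (out # rs) b (b + 1))"
| "compiles [] rs k b = skip"
| "compiles (g # gs) rs k b = compile g rs k b ;; compiles gs rs (Suc k) b"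

text \<open>Quantifying over all stores and register assignments makes the induction on
  \<open>f\<close> go through, as \<open>compile\<close> runs subterms on other registers.\<close>

definition implements :: "recf \<Rightarrow> bool" where
  "implements f \<longleftrightarrow> (\<forall>s rs out b y. computes f (map s rs) y \<longrightarrow> (\<forall>r\<in>set rs. r < b \<and> r \<noteq> out) \<longrightarrow>
     out < b \<longrightarrow> s out = 0 \<longrightarrow> (\<forall>k\<ge>b. s k = 0) \<longrightarrow> bigstep (compile f rs out b) s (s(out := y)))"

lemma implementsD:
  assumes "implements f" "computes f xs y" "map s rs = xs" "\<forall>r\<in>set rs. r < b \<and> r \<noteq> out"
    "out < b" "s out = 0" "\<forall>k\<ge>b. s k = 0" "s' = s(out := y)"
  shows "bigstep (compile f rs out b) s s'"
  using assms unfolding implements_def by blast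

text \<open>The results go to \<open>k\<close>, \<open>k + 1\<close> and so on, above all argument
  registers and below the scratch space, so earlier results survive and every call sees the same
  arguments.\<close>

lemma bigstep_compiles:
  assumes "\<forall>g\<in>set gs. implements g" "list_all2 (\<lambda>g y. computes g (map s rs) y) gs ys"
    "k + length gs \<le> b" "\<forall>r\<in>set rs. r < k" "\<forall>r\<ge>k. s r = 0"
  shows "bigstep (compiles gs rs k b) s (\<lambda>r. if k \<le> r \<and> r < k + length gs then ys ! (r - k) else s r)"
  using assms
proof (induction gs arbitrary: ys k s)
  case Nil
  have "(\<lambda>r. if k \<le> r \<and> r < k + 0 then ys ! (r - k) else s r) = s" by auto
  then show ?case using bigstep_skip by simp
next
  case (Cons g gs)
  from Cons.prems(2) obtain y ys' where ys: "ys = y # ys'" "computes g (map s rs) y"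
    "list_all2 (\<lambda>g y. computes g (map s rs) y) gs ys'" by (auto simp: list_all2_Cons1)
  let ?s = "s(k := y)"
  have m: "map ?s rs = map s rs" using Cons.prems(4) by auto
  have 1: "bigstep (compile g rs k b) s ?s"
    by (rule implementsD[OF _ ys(2)]) (use Cons.prems in \<open>auto dest: order.strict_trans2\<close>)
  have z: "\<forall>r\<ge>Suc k. ?s r = 0" using Cons.prems by auto
  have "bigstep (compiles gs rs (Suc k) b) ?s
     (\<lambda>r. if Suc k \<le> r \<and> r < Suc k + length gs then ys' ! (r - Suc k) else ?s r)"
    by (rule Cons.IH, unfold m) (use Cons.prems z ys(3) in \<open>auto simp: less_Suc_eq\<close>)
  moreover have "(\<lambda>r. if Suc k \<le> r \<and> r < Suc k + length gs then ys' ! (r - Suc k) else ?s r)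
    = (\<lambda>r. if k \<le> r \<and> r < k + length (g # gs) then ys ! (r - k) else s r)"
    by (auto simp: ys(1) fun_eq_iff nth_Cons')
  ultimately show ?case using 1 by (auto intro: bigstep.Seq)
qed

lemma compile_correct: "implements f"
proof (induction f)
  case Zero
  show ?case unfolding implements_def
  proof (intro allI impI)
    fix s :: store and rs out b y assume "computes Zero (map s rs) y" "s out = 0"
    then have "s(out := y) = s" by (metis computes_elims(1) fun_upd_triv)
    then show "bigstep (compile Zero rs out b) s (s(out := y))" using bigstep_skip by simp
  qed
next
  case Succ
  show ?case unfolding implements_def
  proof (intro allI impI)
    fix s :: store and rs out b y
    assume *: "computes Succ (map s rs) y" "\<forall>r\<in>set rs. r < b \<and> r \<noteq> out" "out < b" "s out = 0"
      "\<forall>k\<ge>b. s k = 0"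
    then obtain r where r: "rs = [r]" "y = Suc (s r)" by (auto elim: computes_elims)
    show "bigstep (compile Succ rs out b) s (s(out := y))"
      using * r by (auto intro!: bigstep.Seq[OF bigstep_copy bigstep_inc])
  qed
next
  case (Proj i)
  show ?case unfolding implements_def
  proof (intro allI impI)
    fix s :: store and rs out b y
    assume *: "computes (Proj i) (map s rs) y" "\<forall>r\<in>set rs. r < b \<and> r \<noteq> out" "out < b" "s out = 0"
      "\<forall>k\<ge>b. s k = 0"
    then have r: "i < length rs" "y = s (rs ! i)" by (auto elim: computes_elims)
    then have "rs ! i < b" "rs ! i \<noteq> out" "rs ! i \<noteq> b" using *(2) by auto
    then show "bigstep (compile (Proj i) rs out b) s (s(out := y))"
      using * r bigstep_copy[of "rs ! i" out b s] by auto
  qed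
next
  case (Comp f gs)
  show ?case unfolding implements_def
  proof (intro allI impI)
    fix s :: store and rs out b y
    assume *: "computes (Comp f gs) (map s rs) y" "\<forall>r\<in>set rs. r < b \<and> r \<noteq> out" "out < b" "s out = 0"
      "\<forall>k\<ge>b. s k = 0"
    from *(1) obtain ys where ys: "list_all2 (\<lambda>g y. computes g (map s rs) y) gs ys" "computes f ys y"
      by (rule computes_elims)
    let ?m = "length gs"
    have len: "length ys = ?m" using ys(1) by (simp add: list_all2_lengthD)
    let ?s1 = "\<lambda>r. if b \<le> r \<and> r < b + ?m then ys ! (r - b) else s r"
    have 1: "bigstep (compiles gs rs b (b + ?m)) s ?s1"
      by (rule bigstep_compiles) (use Comp.IH(2) ys * in auto)
    have 2: "bigstep (compile f [b..<b + ?m] out (b + ?m)) ?s1 (?s1(out := y))"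
    proof (rule implementsD[OF Comp.IH(1) ys(2)])
      show "map ?s1 [b..<b + ?m] = ys" using len by (intro nth_equalityI) auto
    qed (use * in auto)
    have 3: "bigstep (clears b ?m) (?s1(out := y))
        (\<lambda>r. if b \<le> r \<and> r < b + ?m then 0 else (?s1(out := y)) r)"
      by (rule bigstep_clears)
    have "(\<lambda>r. if b \<le> r \<and> r < b + ?m then 0 else (?s1(out := y)) r) = s(out := y)"
      using * by (auto simp: fun_eq_iff)
    then show "bigstep (compile (Comp f gs) rs out b) s (s(out := y))"
      using 1 2 3 by (auto intro: bigstep.Seq)
  qed
next
  case (Prim_Rec f g)
  show ?case unfolding implements_def
  proof (intro allI impI)
    fix s :: store and rs out b y
    assume *: "computes (Prim_Rec f g) (map s rs) y" "\<forall>r\<in>set rs. r < b \<and> r \<noteq> out" "out < b" "s out = 0"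
      "\<forall>k\<ge>b. s k = 0"
    from *(1) obtain r rs' where rs: "rs = r # rs'"
      by (cases rs) (auto elim: computes.cases)
    let ?xs = "map s rs'"
    let ?n = "s r"
    \<comment> \<open>A derivation for an argument contains derivations for all smaller ones, so
      every intermediate value \<open>h n\<close> exists.\<close>
    have "\<exists>z. computes (Prim_Rec f g) (n # ?xs) z" if "computes (Prim_Rec f g) (m # ?xs) y" "n \<le> m"
      for n m y using that
    proof (induction m arbitrary: y)
      case (Suc m)
      then show ?case by (cases "n = Suc m") (auto elim: computes_elims simp: le_Suc_eq)
    qed auto
    then obtain h where h: "\<And>n. n \<le> ?n \<Longrightarrow> computes (Prim_Rec f g) (n # ?xs) (h n)"
      using * rs by simp metis
    have hy: "h ?n = y" using h[of ?n] *(1) rs computes_functional by auto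
    have h0: "computes f ?xs (h 0)" using h[of 0] by (auto elim: computes_elims)
    have hS: "computes g (n # h n # ?xs) (h (Suc n))" if "n < ?n" for n
    proof -
      have "computes (Prim_Rec f g) (Suc n # ?xs) (h (Suc n))" using that h by simp
      then obtain q where "computes (Prim_Rec f g) (n # ?xs) q" "computes g (n # q # ?xs) (h (Suc n))"
        by (rule computes_elims)
      then show ?thesis using h[of n] that computes_functional by fastforce
    qed
    \<comment> \<open>Loop invariant: \<open>b\<close> counts the rounds done, \<open>b + 1\<close>
      the rounds left, and \<open>out\<close> holds the value reached so far.\<close>
    let ?st = "\<lambda>n. s(b := n, b + 1 := ?n - n, out := h n)"
    let ?body = "compile g (b # out # rs') (b + 2) (b + 3) ;;
       clear out ;; move (b + 2) out ;; inc b ;; dec (b + 1)"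
    have body: "bigstep ?body (?st n) (?st (Suc n))" if "n < ?n" for n
    proof -
      have 1: "bigstep (compile g (b # out # rs') (b + 2) (b + 3)) (?st n)
          ((?st n)(b + 2 := h (Suc n)))"
        by (rule implementsD[OF Prim_Rec.IH(2) hS[OF that]]) (use * rs in auto)
      have 2: "bigstep (clear out) ((?st n)(b + 2 := h (Suc n)))
          ((?st n)(b + 2 := h (Suc n), out := 0))"
        by (rule bigstep_clear)
      have "bigstep (move (b + 2) out) ((?st n)(b + 2 := h (Suc n), out := 0))
         (((?st n)(b + 2 := h (Suc n), out := 0))(out := 0 + h (Suc n), b + 2 := 0))"
        using bigstep_move[of "b + 2" out "(?st n)(b + 2 := h (Suc n), out := 0)"] *(3) by simp
      moreover have "((?st n)(b + 2 := h (Suc n), out := 0))(out := 0 + h (Suc n), b + 2 := 0)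
         = s(b := n, b + 1 := ?n - n, out := h (Suc n))" using * by auto
      ultimately have 3: "bigstep (move (b + 2) out) ((?st n)(b + 2 := h (Suc n), out := 0))
         (s(b := n, b + 1 := ?n - n, out := h (Suc n)))" by simp
      have 4: "bigstep (inc b) (s(b := n, b + 1 := ?n - n, out := h (Suc n)))
         (s(b := Suc n, b + 1 := ?n - n, out := h (Suc n)))"
        by (rule bigstep_inc) (use * in auto)
      have 5: "bigstep (dec (b + 1)) (s(b := Suc n, b + 1 := ?n - n, out := h (Suc n))) (?st (Suc n))"
        by (rule bigstep_dec[of _ _ "?n - Suc n"]) (use * that in auto)
      from 1 2 3 4 5 show ?thesis by (blast intro: bigstep.Seq)
    qed
    have loop: "bigstep (Loop (b + 1) ?body) (?st (?n - k)) (?st ?n)" if "k \<le> ?n" for k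
      using that
    proof (induction k)
      case 0
      then show ?case using * by (auto intro: bigstep.Loop_exit)
    next
      case (Suc k)
      then have "Suc (?n - Suc k) = ?n - k" by auto
      with body[of "?n - Suc k"] Suc.prems
      have 1: "bigstep ?body (?st (?n - Suc k)) (?st (?n - k))" by simp
      have 2: "bigstep (Loop (b + 1) ?body) (?st (?n - k)) (?st ?n)" by (rule Suc.IH) (use Suc.prems in simp)
      show ?case by (rule bigstep.Loop_iter[OF _ 1 2]) (use Suc.prems * in simp)
    qed
    have 1: "bigstep (copy r (b + 1) b) s (s(b + 1 := ?n))"
      using bigstep_copy[of r "b + 1" b s] * rs by auto
    have e: "s(b + 1 := ?n, out := h 0) = ?st 0" using * by auto
    have "bigstep (compile f rs' out (b + 2)) (s(b + 1 := ?n)) (s(b + 1 := ?n, out := h 0))"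
      by (rule implementsD[OF Prim_Rec.IH(1) h0]) (use * rs in auto)
    then have 2: "bigstep (compile f rs' out (b + 2)) (s(b + 1 := ?n)) (?st 0)" by (simp only: e)
    have 3: "bigstep (Loop (b + 1) ?body) (?st 0) (?st ?n)" using loop[of ?n] by simp
    have e: "(?st ?n)(b := 0) = s(out := y)" using * hy by auto
    have 4: "bigstep (clear b) (?st ?n) (s(out := y))" unfolding e[symmetric] by (rule bigstep_clear)
    from 1 2 3 4 show "bigstep (compile (Prim_Rec f g) rs out b) s (s(out := y))"
      unfolding compile.simps rs list.sel by (blast intro: bigstep.Seq)
  qed
next
  case (Mu f)
  show ?case unfolding implements_def
  proof (intro allI impI)
    fix s :: store and rs out b y
    assume *: "computes (Mu f) (map s rs) y" "\<forall>r\<in>set rs. r < b \<and> r \<noteq> out" "out < b" "s out = 0"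
      "\<forall>k\<ge>b. s k = 0"
    let ?xs = "map s rs"
    from *(1) have y: "computes f (y # ?xs) 0" "\<forall>m<y. \<exists>k. computes f (m # ?xs) (Suc k)"
      by (rule computes_elims, blast)+
    then obtain h where h: "\<And>m. m < y \<Longrightarrow> computes f (m # ?xs) (Suc (h m))" by metis
    \<comment> \<open>\<open>g m\<close> is the value of \<open>f\<close> at the candidate
      \<open>m\<close> held in \<open>out\<close>. Stored in \<open>b\<close>, it is positive for
      \<open>m < y\<close> and zero at \<open>y\<close>, so the loop stops exactly there.\<close>
    define g where "g m = (if m = y then 0 else Suc (h m))" for m
    have g: "computes f (m # ?xs) (g m)" if "m \<le> y" for m using that h y(1) by (auto simp: g_def)
    let ?st = "\<lambda>n. s(out := n, b := g n)"
    have F: "bigstep (compile f (out # rs) b (b + 1)) (s(out := m)) (?st m)" if "m \<le> y" for m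
      by (rule implementsD[OF Mu.IH g[OF that]]) (use * in \<open>auto dest: order.strict_trans\<close>)
    let ?body = "clear b ;; inc out ;; compile f (out # rs) b (b + 1)"
    have body: "bigstep ?body (?st n) (?st (Suc n))" if "n < y" for n
    proof -
      have "(?st n)(b := 0) = s(out := n)" using * by auto
      then have 1: "bigstep (clear b) (?st n) (s(out := n))" using bigstep_clear[of b "?st n"] by simp
      have 2: "bigstep (inc out) (s(out := n)) (s(out := Suc n))" by (rule bigstep_inc) auto
      from 1 2 F[of "Suc n"] that show ?thesis by (auto intro: bigstep.Seq)
    qed
    have loop: "bigstep (Loop b ?body) (?st (y - k)) (?st y)" if "k \<le> y" for k
      using that
    proof (induction k)
      case 0
      then show ?case by (auto intro: bigstep.Loop_exit simp: g_def)
    next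
      case (Suc k)
      then have "Suc (y - Suc k) = y - k" by auto
      with body[of "y - Suc k"] Suc.prems
      have 1: "bigstep ?body (?st (y - Suc k)) (?st (y - k))" by simp
      have 2: "bigstep (Loop b ?body) (?st (y - k)) (?st y)" by (rule Suc.IH) (use Suc.prems in simp)
      show ?case by (rule bigstep.Loop_iter[OF _ 1 2]) (use Suc.prems in \<open>simp add: g_def\<close>)
    qed
    have e: "s(out := 0) = s" "?st y = s(out := y)" using * by (auto simp: g_def)
    show "bigstep (compile (Mu f) rs out b) s (s(out := y))"
      using bigstep.Seq[OF F[of 0] loop[of y, simplified]] e by simp
  qed
qed

section \<open>Counter programs\<close>

datatype instr = Add nat int | Br nat nat nat

inductive mstep :: "instr list \<Rightarrow> nat \<times> store \<Rightarrow> nat \<times> store \<Rightarrow> bool" for prog where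
  Add: "\<lbrakk>q < length prog; prog ! q = Add j d; 0 \<le> int (c j) + d\<rbrakk>
    \<Longrightarrow> mstep prog (q, c) (Suc q, c(j := nat (int (c j) + d)))"
| Br: "\<lbrakk>q < length prog; prog ! q = Br j k k'\<rbrakk>
    \<Longrightarrow> mstep prog (q, c) (if c j = 0 then k else k', c)"

text \<open>Addresses are absolute, \<open>n\<close> being that of the first instruction. The final
  \<open>Br j n n\<close> is an unconditional jump back to the test; the offset 2 counts the two
  branches around the body.\<close>

fun assemble :: "nat \<Rightarrow> com \<Rightarrow> instr list" where
  "assemble n (Upd j d) = [Add j d]"
| "assemble n (c ;; c') = (let p = assemble n c in p @ assemble (n + length p) c')"
| "assemble n (Loop j c) = (let p = assemble (Suc n) c; k = n + length p + 2 in
     Br j k (Suc n) # p @ [Br j n n])"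

lemma assemble_correct:
  assumes "bigstep c s s'" "prog = pre @ assemble (length pre) c @ post"
  shows "(mstep prog)\<^sup>*\<^sup>* (length pre, s) (length pre + length (assemble (length pre) c), s')"
  using assms
proof (induction arbitrary: pre post rule: bigstep.induct)
  case (Upd s j d)
  have "prog ! length pre = Add j d" "length pre < length prog" using Upd(2) by auto
  from mstep.Add[of _ prog j d s, OF this(2,1) Upd(1)] show ?case
    by (simp add: r_into_rtranclp del: fun_upd_apply)
next
  case (Seq c s s' c' s'')
  let ?p = "assemble (length pre) c"
  let ?p' = "assemble (length (pre @ ?p)) c'"
  have "prog = pre @ ?p @ (?p' @ post)" "prog = (pre @ ?p) @ ?p' @ post"
    using Seq.prems by (auto simp: Let_def)
  from Seq.IH(1)[OF this(1)] Seq.IH(2)[OF this(2)]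
  show ?case by (auto simp: Let_def add.assoc)
next
  case (Loop_exit s j c)
  let ?n = "length pre"
  have "prog ! ?n = Br j (?n + length (assemble (Suc ?n) c) + 2) (Suc ?n)" "?n < length prog"
    using Loop_exit(2) by (auto simp: Let_def)
  from mstep.Br[OF this(2,1), of s] Loop_exit(1) show ?case by (auto simp: Let_def)
next
  case (Loop_iter s j c s' s'')
  let ?n = "length pre"
  let ?p = "assemble (Suc ?n) c"
  let ?k = "?n + length ?p + 2"
  have eq: "prog = (pre @ [Br j ?k (Suc ?n)]) @ assemble (length (pre @ [Br j ?k (Suc ?n)])) c @ Br j ?n ?n # post"
    using Loop_iter.prems by (auto simp: Let_def)
  have "prog ! ?n = Br j ?k (Suc ?n)" "?n < length prog"
    using Loop_iter.prems by (auto simp: Let_def)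
  from mstep.Br[OF this(2,1), of s] Loop_iter.hyps(1)
  have 1: "mstep prog (?n, s) (Suc ?n, s)" by simp
  have 2: "(mstep prog)\<^sup>*\<^sup>* (Suc ?n, s) (Suc ?n + length ?p, s')"
    using Loop_iter.IH(1)[OF eq] by simp
  have "prog ! (Suc ?n + length ?p) = Br j ?n ?n" "Suc ?n + length ?p < length prog"
    using Loop_iter.prems by (auto simp: Let_def nth_append)
  from mstep.Br[OF this(2,1), of s'] have 3: "mstep prog (Suc ?n + length ?p, s') (?n, s')"
    by simp
  from 1 2 3 Loop_iter.IH(2)[OF Loop_iter.prems] show ?case
    by (meson converse_rtranclp_into_rtranclp rtranclp_trans)
qed

section \<open>The automaton of a counter program\<close>

text \<open>
  Clock \<open>0\<close> measures cycles of length \<open>p\<close>, and at the beginning of a cycle clock \<open>i + 1\<close> holds the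
  value of counter \<open>i\<close>. A clock that is reset when it equals \<open>p - d\<close> has gained \<open>d\<close> at the
  end of the cycle. Parameter \<open>0\<close> is the lower-bound and parameter \<open>1\<close> the upper-bound one; the
  constraint \<open>x = p + c\<close> becomes a pair of bounds, satisfiable only if the lower-bound parameter does
  not exceed the upper-bound one.

  Location \<open>0\<close> is initial, \<open>1\<close> is a dead end that can be entered from anywhere, \<open>2\<close> loops forever,
  \<open>3 + 2 * q\<close> belongs to instruction \<open>q\<close>, and \<open>4 + 2 * q\<close> to the remainder of its cycle after
  its counter has been updated.
\<close>

definition eq_par :: "nat \<Rightarrow> int \<Rightarrow> constr" where
  "eq_par x c = [Clk_Par x GE 0 c, Clk_Par x LE 1 c]"

text \<open>For \<open>Add j d\<close> this is the only edge in which \<open>d\<close> occurs.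
  Keeping it apart from \<open>aux_edges\<close> isolates the numbers that the program will load
  about itself.\<close>

fun op_edge :: "nat \<times> instr \<Rightarrow> edge" where
  "op_edge (q, Add j d) = (3 + 2 * q, eq_par (Suc j) (- d), 0, [Suc j], 4 + 2 * q)"
| "op_edge (q, Br j k k') = (3 + 2 * q, [Clk_Const 0 EQ 0, Clk_Const (Suc j) EQ 0], 0, [], 3 + 2 * k)"

text \<open>The clock of an unchanged counter wraps around at \<open>p\<close>. The bound on clock
  \<open>0\<close> confines the reset to the current cycle, which rules out a second reset as long
  as the counter is below \<open>p\<close>.\<close>

definition hold_edges :: "nat \<Rightarrow> nat \<Rightarrow> nat \<Rightarrow> edge list" where
  "hold_edges K j l = map (\<lambda>i. (l, Clk_Par 0 LE 1 0 # eq_par (Suc i) 0, 0, [Suc i], l))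
     (filter (\<lambda>i. i \<noteq> j) [0..<K])"

text \<open>The strict bounds on the edge that closes a cycle force every counter clock to have been
  reset, since otherwise it would show at least \<open>p\<close>. Branches require clock
  \<open>0\<close> to be zero, so no time passes in them.\<close>

fun aux_edges :: "nat \<Rightarrow> nat \<times> instr \<Rightarrow> edge list" where
  "aux_edges K (q, Add j d) =
     (4 + 2 * q, eq_par 0 0 @ map (\<lambda>i. Clk_Par (Suc i) LT 1 0) [0..<K], 0, [0], 5 + 2 * q) #
     hold_edges K j (3 + 2 * q) @ hold_edges K j (4 + 2 * q)"
| "aux_edges K (q, Br j k k') =
     [(3 + 2 * q, [Clk_Const 0 EQ 0, Clk_Const (Suc j) GT 0], 0, [], 3 + 2 * k')]"

text \<open>The edge into the program waits for time \<open>p\<close> before resetting all clocks,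
  so it is open only if the lower-bound parameter does not exceed the upper-bound one. The self-loop
  at the halting location tests the output counter.\<close>

definition base_edges :: "nat \<Rightarrow> nat \<Rightarrow> nat \<Rightarrow> edge list" where
  "base_edges N n out =
     [(0, [Clk_Par 0 GT 0 0, Clk_Par 0 LT 1 0], 1, [], 1),
      (0, [Clk_Par 0 GE 0 0, Clk_Const 0 LE 0], 0, [], 2),
      (2, [], 0, [], 2),
      (0, eq_par 0 0, 0, [0..<N], 3),
      (3 + 2 * n, [Clk_Const (Suc out) EQ 0], 0, [], 3 + 2 * n)] @
     map (\<lambda>l. (l, [], 0, [], 1)) (filter (\<lambda>l. l \<noteq> 1) [0..<N])"

text \<open>\<open>N\<close> bounds both the locations and the clocks, so that their two lists share
  one code.\<close>

definition machine_pta :: "nat \<Rightarrow> nat \<Rightarrow> nat \<Rightarrow> instr list \<Rightarrow> pta" where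
  "machine_pta N K out prog =
     \<lparr>acts = [0, 1], locs = [0..<N], init = 0, clocks = [0..<N], params = [0, 1],
      inv_of = (\<lambda>_. []),
      edges = map op_edge (enumerate 0 prog) @ concat (map (aux_edges K) (enumerate 0 prog)) @
        base_edges N (length prog) out\<rparr>"

fun wf_instr :: "nat \<Rightarrow> nat \<Rightarrow> instr \<Rightarrow> bool" where
  "wf_instr N K (Add j d) \<longleftrightarrow> j < K"
| "wf_instr N K (Br j k k') \<longleftrightarrow> j < K \<and> 3 + 2 * k < N \<and> 3 + 2 * k' < N"

locale machine =
  fixes N K out :: nat and prog :: "instr list"
  assumes wf_prog: "\<forall>i\<in>set prog. wf_instr N K i"
    and out_less: "out < K" and K_less: "K < N" and N_large: "4 + 2 * length prog < N"
begin

abbreviation (input) A :: pta where "A \<equiv> machine_pta N K out prog"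

lemma edges_iff:
  "e \<in> set (edges A) \<longleftrightarrow>
     (\<exists>q<length prog. e = op_edge (q, prog ! q) \<or> e \<in> set (aux_edges K (q, prog ! q))) \<or>
     e \<in> set (base_edges N (length prog) out)"
proof -
  have "set (enumerate 0 prog) = (\<lambda>q. (q, prog ! q)) ` {..<length prog}"
    by (auto simp: in_set_enumerate_eq)
  then show ?thesis by (auto simp: machine_pta_def)
qed

lemma pta_simps [simp]:
  "acts A = [0, 1]" "locs A = [0..<N]" "init A = 0" "clocks A = [0..<N]" "params A = [0, 1]"
  "inv_of A l = []"
  by (simp_all add: machine_pta_def)

lemma wf_nth: "q < length prog \<Longrightarrow> wf_instr N K (prog ! q)"
  using wf_prog by simp

lemma wf_machine_pta: "wf_pta A"
proof -
  have "l < N \<and> wf_constr A g \<and> a \<in> {0, 1} \<and> set R \<subseteq> {..<N} \<and> l' < N"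
    if "(l, g, a, R, l') \<in> set (edges A)" for l g a R l'
    using that unfolding edges_iff
  proof (elim disjE exE conjE)
    fix q assume q: "q < length prog" "(l, g, a, R, l') = op_edge (q, prog ! q)"
    then show ?thesis using wf_nth[OF q(1)] K_less N_large
      by (cases "prog ! q") (auto simp: wf_constr_def eq_par_def)
  next
    fix q assume q: "q < length prog" "(l, g, a, R, l') \<in> set (aux_edges K (q, prog ! q))"
    then show ?thesis using wf_nth[OF q(1)] K_less N_large
      by (cases "prog ! q") (auto simp: wf_constr_def eq_par_def hold_edges_def)
  next
    assume "(l, g, a, R, l') \<in> set (base_edges N (length prog) out)"
    then show ?thesis using out_less K_less N_large
      by (auto simp: wf_constr_def eq_par_def base_edges_def)
  qed
  then have "\<forall>(l, g, a, R, l')\<in>set (edges A). l < N \<and> wf_constr A g \<and> (a = 0 \<or> a = 1) \<and>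
      set R \<subseteq> {0..<N} \<and> l' < N" by fastforce
  then show ?thesis using N_large by (simp add: wf_pta_def wf_constr_def)
qed

lemma lu_machine_pta: "lu_partition A {0} {1}"
proof -
  have "lu_atom {0} {1} b" if "(l, g, a, R, l') \<in> set (edges A)" "b \<in> set g" for l g a R l' b
    using that unfolding edges_iff
  proof (elim disjE exE conjE)
    fix q assume q: "q < length prog" "(l, g, a, R, l') = op_edge (q, prog ! q)"
    then show ?thesis using that(2) by (cases "prog ! q") (auto simp: eq_par_def)
  next
    fix q assume q: "q < length prog" "(l, g, a, R, l') \<in> set (aux_edges K (q, prog ! q))"
    then show ?thesis using that(2)
      by (cases "prog ! q") (auto simp: eq_par_def hold_edges_def)
  next
    assume "(l, g, a, R, l') \<in> set (base_edges N (length prog) out)"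
    then show ?thesis using that(2) by (auto simp: eq_par_def base_edges_def)
  qed
  moreover have "C = [] \<or> (\<exists>l a R l'. (l, C, a, R, l') \<in> set (edges A))" if "C \<in> constrs A" for C
    using that by (auto simp: constrs_def)
  ultimately have "\<forall>C\<in>constrs A. \<forall>b\<in>set C. lu_atom {0} {1} b"
    by (metis empty_iff empty_set)
  then show ?thesis by (simp add: lu_partition_def insert_commute)
qed

text \<open>With empty invariants, being a configuration only means being at a valid location, which
  holds at both ends of every edge.\<close>

lemma step_iff:
  "step A v (l, w) a (l', w') \<longleftrightarrow> (\<exists>g R d. (l, g, a, R, l') \<in> set (edges A) \<and> 0 \<le> d \<and>
     sat v (delay w d) g \<and> w' = reset (set R) (delay w d))"
proof -
  have "is_config A v (l, w) \<longleftrightarrow> l < N" for l w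
    by (simp add: is_config_def sat_def)
  moreover have "l < N \<and> l' < N" if "(l, g, a, R, l') \<in> set (edges A)" for g R
    using wf_machine_pta that by (fastforce simp: wf_pta_def)
  ultimately show ?thesis unfolding step.simps by simp blast
qed

section \<open>Outgoing edges of each location\<close>

lemma fst_op_edge: "fst (op_edge (q, i)) = 3 + 2 * q"
  by (cases i) auto

lemma fst_aux_edges: "e \<in> set (aux_edges K (q, i)) \<Longrightarrow> fst e = 3 + 2 * q \<or> fst e = 4 + 2 * q"
  by (cases i) (auto simp: hold_edges_def)

lemma edges_low:
  assumes "l < 3 \<or> l \<ge> 3 + 2 * length prog"
  shows "(l, g, a, R, l') \<in> set (edges A) \<longleftrightarrow> (l, g, a, R, l') \<in> set (base_edges N (length prog) out)"
proof -
  have "(l, g, a, R, l') \<noteq> op_edge (q, i)" if "q < length prog" for q i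
  proof
    assume "(l, g, a, R, l') = op_edge (q, i)"
    then have "l = 3 + 2 * q" using fst_op_edge[of q i] by (metis fst_conv)
    then show False using assms that by auto
  qed
  moreover have "(l, g, a, R, l') \<notin> set (aux_edges K (q, i))" if "q < length prog" for q i
    using fst_aux_edges[of "(l, g, a, R, l')" q i] assms that by auto
  ultimately show ?thesis unfolding edges_iff by blast
qed

text \<open>The location determines \<open>q\<close>, so the other instructions contribute nothing;
  the remaining edge leads to the dead end.\<close>

lemma edges_high:
  assumes "q < length prog" "l = 3 + 2 * q \<or> l = 4 + 2 * q"
  shows "(l, g, a, R, l') \<in> set (edges A) \<longleftrightarrow> (l, g, a, R, l') = op_edge (q, prog ! q) \<or>
     (l, g, a, R, l') \<in> set (aux_edges K (q, prog ! q)) \<or> (g, a, R, l') = ([], 0, [], 1)"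
proof -
  have eq: "q' = q" if "l = 3 + 2 * q' \<or> l = 4 + 2 * q'" for q'
    using assms(2) that by presburger
  have "q' = q" if "(l, g, a, R, l') = op_edge (q', i)" for q' i
    using fst_op_edge[of q' i] that eq by (metis fst_conv)
  moreover have "q' = q" if "(l, g, a, R, l') \<in> set (aux_edges K (q', i))" for q' i
    using fst_aux_edges[OF that] eq by simp
  moreover have "(l, g, a, R, l') \<in> set (base_edges N (length prog) out) \<longleftrightarrow> (g, a, R, l') = ([], 0, [], 1)"
  proof -
    have "l \<noteq> 0" "l \<noteq> 1" "l \<noteq> 2" "l < N" using assms N_large by auto
    moreover have "l \<noteq> 3 + 2 * length prog" using assms by presburger
    ultimately show ?thesis by (auto simp: base_edges_def)
  qed
  ultimately show ?thesis unfolding edges_iff using assms(1) by blast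
qed

lemma sink_no_step: "\<not> step A v (1, w) a C"
  by (cases C) (auto simp: step_iff edges_low base_edges_def)

lemma step_sink: "l < N \<Longrightarrow> l \<noteq> 1 \<Longrightarrow> step A v (l, w) 0 (1, w)"
  unfolding step_iff
  by (intro exI[of _ "[]"] exI[of _ "0::real"])
    (auto simp: edges_iff base_edges_def sat_def delay_def reset_def)

lemma init_edges:
  "(0, g, a, R, l') \<in> set (edges A) \<longleftrightarrow> (g, a, R, l') \<in>
     {([Clk_Par 0 GT 0 0, Clk_Par 0 LT 1 0], 1, [], 1), ([Clk_Par 0 GE 0 0, Clk_Const 0 LE 0], 0, [], 2),
      (eq_par 0 0, 0, [0..<N], 3), ([], 0, [], 1)}"
  using N_large by (auto simp: edges_low base_edges_def)

lemma accept_edges: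
  "(3 + 2 * length prog, g, a, R, l') \<in> set (edges A) \<longleftrightarrow> (g, a, R, l') \<in>
     {([], 0, [], 1), ([Clk_Const (Suc out) EQ 0], 0, [], 3 + 2 * length prog)}"
  using N_large by (auto simp: edges_low base_edges_def)

lemma Br_edges:
  assumes "q < length prog" "prog ! q = Br j k k'"
  shows "(3 + 2 * q, g, a, R, l') \<in> set (edges A) \<longleftrightarrow> (g, a, R, l') \<in>
     {([], 0, [], 1), ([Clk_Const 0 EQ 0, Clk_Const (Suc j) EQ 0], 0, [], 3 + 2 * k),
      ([Clk_Const 0 EQ 0, Clk_Const (Suc j) GT 0], 0, [], 3 + 2 * k')}"
  using assms(2) by (auto simp: edges_high[OF assms(1)])

lemma Add_edges:
  assumes "q < length prog" "prog ! q = Add j d" "l = 3 + 2 * q \<or> l = 4 + 2 * q"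
  shows "(l, g, a, R, l') \<in> set (edges A) \<longleftrightarrow> (g, a, R, l') = ([], 0, [], 1) \<or>
     l = 3 + 2 * q \<and> (g, a, R, l') = (eq_par (Suc j) (- d), 0, [Suc j], 4 + 2 * q) \<or>
     l = 4 + 2 * q \<and> (g, a, R, l') =
       (eq_par 0 0 @ map (\<lambda>i. Clk_Par (Suc i) LT 1 0) [0..<K], 0, [0], 3 + 2 * Suc q) \<or>
     (\<exists>i<K. i \<noteq> j \<and> (g, a, R, l') = (Clk_Par 0 LE 1 0 # eq_par (Suc i) 0, 0, [Suc i], l))"
  unfolding edges_high[OF assms(1,3)] using assms(2,3) by (auto simp: hold_edges_def)

end

section \<open>Runs of the automaton\<close>

context machine
begin

text \<open>At the initial configuration, this property decides whether a valuation with equal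
  parameters has the reference language.\<close>

definition alive :: "pval \<Rightarrow> config \<Rightarrow> bool" where
  "alive v s \<longleftrightarrow> (\<exists>\<rho>. \<rho> 0 = s \<and> (\<forall>i::nat. step A v (\<rho> i) 0 (\<rho> (Suc i))))"

lemma alive_stepE:
  assumes "alive v s"
  obtains s' where "step A v s 0 s'" "alive v s'"
proof -
  from assms obtain \<rho> where "\<rho> 0 = s" "\<forall>i::nat. step A v (\<rho> i) 0 (\<rho> (Suc i))"
    by (auto simp: alive_def)
  then have "step A v s 0 (\<rho> 1)" "alive v (\<rho> 1)"
    unfolding alive_def by (metis One_nat_def, intro exI[of _ "\<lambda>i. \<rho> (Suc i)"], simp)
  then show ?thesis by (rule that)
qed

lemma alive_back:
  assumes "step A v s 0 s'" "alive v s'"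
  shows "alive v s"
proof -
  from assms(2) obtain \<rho> where "\<rho> 0 = s'" "\<forall>i::nat. step A v (\<rho> i) 0 (\<rho> (Suc i))"
    by (auto simp: alive_def)
  with assms(1) have "\<forall>i. step A v (case_nat s \<rho> i) 0 (case_nat s \<rho> (Suc i))"
    by (auto split: nat.split)
  then show ?thesis unfolding alive_def by (intro exI[of _ "case_nat s \<rho>"]) simp
qed

lemma alive_loop: "step A v s 0 s \<Longrightarrow> alive v s"
  unfolding alive_def by (intro exI[of _ "\<lambda>_. s"]) simp

lemma sink_not_alive: "\<not> alive v (1, w)"
  using sink_no_step by (metis alive_stepE)

lemma sat_Nil [simp]: "sat v w []"
  and sat_Cons [simp]: "sat v w (b # g) \<longleftrightarrow> sat_atom v w b \<and> sat v w g"
  and sat_append [simp]: "sat v w (g @ g') \<longleftrightarrow> sat v w g \<and> sat v w g'"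
  by (auto simp: sat_def)

lemma sat_eq_par [simp]:
  "sat v w (eq_par x c) \<longleftrightarrow> real_of_rat (v 0) + of_int c \<le> w x \<and> w x \<le> real_of_rat (v 1) + of_int c"
  by (simp add: eq_par_def)

lemma sat_all_less [simp]:
  "sat v w (map (\<lambda>i. Clk_Par (Suc i) LT (Suc 0) 0) [0..<K]) \<longleftrightarrow>
     (\<forall>i<K. w (Suc i) < real_of_rat (v 1))"
  by (auto simp: sat_def)

definition fresh :: "store \<Rightarrow> cval \<Rightarrow> bool" where
  "fresh c w \<longleftrightarrow> w 0 = 0 \<and> (\<forall>i<K. w (Suc i) = real (c i))"

text \<open>
  Within a cycle that turns the counters from \<open>c\<close> to \<open>c'\<close>, the clocks of the counters in \<open>U\<close> have
  not been reset yet, and the clock of counter \<open>i \<notin> U\<close> was reset at time \<open>p - c' i\<close>.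
\<close>

definition in_cycle :: "real \<Rightarrow> store \<Rightarrow> store \<Rightarrow> nat set \<Rightarrow> cval \<Rightarrow> bool" where
  "in_cycle p c c' U w \<longleftrightarrow> 0 \<le> w 0 \<and>
     (\<forall>i<K. if i \<in> U then w (Suc i) = real (c i) + w 0
        else w (Suc i) = real (c' i) + w 0 - p \<and> 0 \<le> w (Suc i))"

end

section \<open>Simulation when both parameters have the same positive value\<close>

locale machine_valuation = machine +
  fixes v :: pval and p :: real
  assumes v_eq: "real_of_rat (v 0) = p" "real_of_rat (v 1) = p" and p_pos: "0 < p"
begin

lemma v_simps: "real_of_rat (v 0) = p" "real_of_rat (v (Suc 0)) = p"
  using v_eq by simp_all

text \<open>An infinite run has no choice within a cycle: each step resets a clock of
  \<open>U\<close> at its only possible time or closes the cycle with \<open>U\<close> empty and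
  counters \<open>c'\<close>; the dead end is fatal. Hence induction on \<open>U\<close>, where the
  location records whether \<open>j\<close> is still in \<open>U\<close>.\<close>

lemma not_alive_Add:
  assumes q: "q < length prog" "prog ! q = Add j d" and d: "0 \<le> int (c j) + d"
    and c': "c' = c(j := nat (int (c j) + d))"
    and cont: "\<And>w. fresh c' w \<Longrightarrow> \<forall>i<K. real (c' i) < p \<Longrightarrow> \<not> alive v (5 + 2 * q, w)"
    and less: "\<forall>i<K. real (c i) < p" and U: "finite U" "U \<subseteq> {..<K}" "in_cycle p c c' U w"
  shows "\<not> alive v (if j \<in> U then 3 + 2 * q else 4 + 2 * q, w)"
proof -
  have j: "j < K" using wf_nth[OF q(1)] q(2) by simp
  have c'j: "real (c' j) = real (c j) + of_int d" using d by (simp add: c')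
  have c'i: "c' i = c i" if "i \<noteq> j" for i using that by (simp add: c')
  have par: "4 + 2 * q \<noteq> 3 + 2 * q" by presburger
  have "(if j \<in> U then 3 + 2 * q else 4 + 2 * q) = 3 + 2 * q \<or>
      (if j \<in> U then 3 + 2 * q else 4 + 2 * q) = 4 + 2 * q" for U by simp
  note edges = Add_edges[OF q this]
  from U show ?thesis
  proof (induction U arbitrary: w rule: finite_psubset_induct)
    case (psubset U)
    let ?l = "if j \<in> U then 3 + 2 * q else 4 + 2 * q"
    note cyc = psubset.prems(2)[unfolded in_cycle_def]
    show ?case
    proof
      assume "alive v (?l, w)"
      then obtain l' w' where st: "step A v (?l, w) 0 (l', w')" and al: "alive v (l', w')"
        by (metis alive_stepE surj_pair)
      from st obtain g R t where e: "(?l, g, 0, R, l') \<in> set (edges A)" and t: "0 \<le> t"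
        and g: "sat v (delay w t) g" and w': "w' = reset (set R) (delay w t)"
        unfolding step_iff by blast
      have drop: False if "i \<in> U" "R = [Suc i]" "w 0 + t = p - real (c' i)"
        "l' = (if j \<in> U - {i} then 3 + 2 * q else 4 + 2 * q)" for i
      proof -
        have "in_cycle p c c' (U - {i}) w'"
          using cyc that(2,3) t unfolding in_cycle_def w' by (auto simp: reset_def delay_def)
        with psubset.IH[of "U - {i}" w'] psubset.prems(1) that(1,4) al show False by auto
      qed
      from e[unfolded edges] show False
      proof (elim disjE exE conjE)
        assume "(g, 0, R, l') = ([], 0, [], 1)"
        with al sink_not_alive show False by simp
      next
        assume 1: "?l = 3 + 2 * q" and 2: "(g, 0, R, l') = (eq_par (Suc j) (- d), 0, [Suc j], 4 + 2 * q)"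
        from 1 par have "j \<in> U" by (auto split: if_splits)
        moreover have "w 0 + t = p - real (c' j)"
          using g 2 cyc j \<open>j \<in> U\<close> c'j by (auto simp: delay_def v_simps)
        ultimately show False using 2 drop[of j] by simp
      next
        assume 1: "?l = 4 + 2 * q" and 2: "(g, 0, R, l') =
           (eq_par 0 0 @ map (\<lambda>i. Clk_Par (Suc i) LT 1 0) [0..<K], 0, [0], 3 + 2 * Suc q)"
        from g 2 have p: "w 0 + t = p" and lt: "\<forall>i<K. w (Suc i) + t < p"
          by (auto simp: delay_def v_simps)
        \<comment> \<open>A clock still in \<open>U\<close> at time \<open>p\<close> would show
          \<open>c i + p\<close>, against the strict bound.\<close>
        have U: "i \<notin> U" if "i < K" for i
        proof
          assume "i \<in> U"
          with cyc that have "w (Suc i) = real (c i) + w 0" by auto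
          with p lt that show False by fastforce
        qed
        have "w (Suc i) + t = real (c' i)" if "i < K" for i
          using cyc U[OF that] that p by fastforce
        then have "fresh c' w'" "\<forall>i<K. real (c' i) < p"
          using lt 2 by (auto simp: fresh_def w' reset_def delay_def)
        from cont[OF this] al 2 show False by simp
      next
        fix i assume i: "i < K" "i \<noteq> j"
          and 2: "(g, 0, R, l') = (Clk_Par 0 LE 1 0 # eq_par (Suc i) 0, 0, [Suc i], ?l)"
        from g 2 have p: "w 0 + t \<le> p" "w (Suc i) + t = p" by (auto simp: delay_def v_simps)
        \<comment> \<open>A second reset in the same cycle would need
          \<open>c i + (w 0 + t) = 2 * p\<close>, but \<open>c i < p\<close> and
          \<open>w 0 + t \<le> p\<close>.\<close>
        have "i \<in> U"
        proof (rule ccontr)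
          assume "i \<notin> U"
          with cyc i have "w (Suc i) = real (c i) + w 0 - p" by (auto simp: c'i)
          with p less i p_pos show False by fastforce
        qed
        moreover from this have "w 0 + t = p - real (c' i)" using p cyc i by (auto simp: c'i)
        ultimately show False using drop[of i] 2 i(2) by simp
      qed
    qed
  qed
qed

text \<open>Resetting the clocks in decreasing order of the new counter values meets every reset
  time \<open>p - c' i\<close>. The last hypothesis on \<open>U\<close> says that none of these
  times has passed.\<close>

lemma alive_Add:
  assumes q: "q < length prog" "prog ! q = Add j d" and d: "0 \<le> int (c j) + d"
    and c': "c' = c(j := nat (int (c j) + d))"
    and cont: "\<And>w. fresh c' w \<Longrightarrow> alive v (5 + 2 * q, w)"
    and less: "\<forall>i<K. real (c' i) < p" and U: "finite U" "U \<subseteq> {..<K}" "in_cycle p c c' U w"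
      "w 0 \<le> p" "\<forall>i\<in>U. w 0 + real (c' i) \<le> p"
  shows "alive v (if j \<in> U then 3 + 2 * q else 4 + 2 * q, w)"
proof -
  have j: "j < K" using wf_nth[OF q(1)] q(2) by simp
  have c'j: "real (c' j) = real (c j) + of_int d" using d by (simp add: c')
  have c'i: "c' i = c i" if "i \<noteq> j" for i using that by (simp add: c')
  have "(if j \<in> U then 3 + 2 * q else 4 + 2 * q) = 3 + 2 * q \<or>
      (if j \<in> U then 3 + 2 * q else 4 + 2 * q) = 4 + 2 * q" for U by simp
  note edges = Add_edges[OF q this]
  from U show ?thesis
  proof (induction U arbitrary: w rule: finite_psubset_induct)
    case (psubset U)
    let ?l = "if j \<in> U then 3 + 2 * q else 4 + 2 * q"
    note cyc = psubset.prems(2)[unfolded in_cycle_def]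
    show ?case
    proof (cases "U = {}")
      case True
      let ?w = "reset {0} (delay w (p - w 0))"
      have w: "w (Suc i) = real (c' i) + w 0 - p" if "i < K" for i using cyc True that by auto
      have "step A v (?l, w) 0 (5 + 2 * q, ?w)"
        unfolding step_iff edges using True w less psubset.prems(3)
        by (intro exI[of _ "eq_par 0 0 @ map (\<lambda>i. Clk_Par (Suc i) LT 1 0) [0..<K]"] exI[of _ "[0]"]
            exI[of _ "p - w 0"]) (auto simp: delay_def v_simps)
      moreover have "fresh c' ?w" using w by (auto simp: fresh_def reset_def delay_def)
      ultimately show ?thesis using cont alive_back by blast
    next
      case False
      \<comment> \<open>The largest new value has the earliest reset time; \<open>t\<close> below is
        the delay until then.\<close>
      have "Max (c' ` U) \<in> c' ` U" using False psubset.hyps by simp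
      then obtain i where i: "i \<in> U" "c' i = Max (c' ` U)" by auto
      have max: "c' k \<le> c' i" if "k \<in> U" for k using psubset.hyps that by (simp add: i(2))
      have iK: "i < K" using i psubset.prems(1) by auto
      define t where "t = p - real (c' i) - w 0"
      have t: "0 \<le> t" using psubset.prems(4) i(1) by (auto simp: t_def)
      let ?w = "reset {Suc i} (delay w t)"
      let ?l' = "if j \<in> U - {i} then 3 + 2 * q else 4 + 2 * q"
      have wi: "w (Suc i) = real (c i) + w 0" using cyc i iK by auto
      have "step A v (?l, w) 0 (?l', ?w)"
      proof (cases "i = j")
        case True
        then show ?thesis unfolding step_iff edges using t i wi c'j
          by (intro exI[of _ "eq_par (Suc j) (- d)"] exI[of _ "[Suc j]"] exI[of _ t])
            (auto simp: delay_def v_simps t_def)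
      next
        case False
        then show ?thesis unfolding step_iff edges using t i wi iK
          by (intro exI[of _ "Clk_Par 0 LE 1 0 # eq_par (Suc i) 0"] exI[of _ "[Suc i]"] exI[of _ t])
            (auto simp: delay_def v_simps t_def c'i)
      qed
      moreover have "alive v (?l', ?w)"
      proof (rule psubset.IH)
        show "in_cycle p c c' (U - {i}) ?w"
          using cyc t unfolding in_cycle_def by (auto simp: reset_def delay_def t_def)
        show "\<forall>k\<in>U - {i}. ?w 0 + real (c' k) \<le> p"
          using max by (auto simp: reset_def delay_def t_def)
      qed (use i psubset.prems(1) in \<open>auto simp: reset_def delay_def t_def\<close>)
      ultimately show ?thesis by (rule alive_back)
    qed
  qed
qed

lemma fresh_in_cycle: "fresh c w \<Longrightarrow> in_cycle p c c' {..<K} w"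
  by (auto simp: fresh_def in_cycle_def)

text \<open>Induction from the end of the halting computation, which an infinite run would have to
  follow up to the blocked self-loop. If a counter outgrows \<open>p\<close>, the cycle cannot be
  closed, which excludes an infinite run as well.\<close>

lemma not_alive_if_rejecting:
  assumes "(mstep prog)\<^sup>*\<^sup>* (q, c) (length prog, s)" "s out \<noteq> 0"
    "fresh c w" "\<forall>i<K. real (c i) < p"
  shows "\<not> alive v (3 + 2 * q, w)"
  using assms(1,3,4)
proof (induction arbitrary: w rule: converse_rtranclp_induct2)
  case refl
  show ?case
  proof
    assume "alive v (3 + 2 * length prog, w)"
    then obtain l' w' where st: "step A v (3 + 2 * length prog, w) 0 (l', w')"
      and al: "alive v (l', w')" by (metis alive_stepE surj_pair)
    from al have "l' \<noteq> 1" using sink_not_alive by auto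
    with st obtain t where "0 \<le> t" "w (Suc out) + t = 0"
      unfolding step_iff accept_edges by (auto simp: delay_def)
    moreover have "w (Suc out) = real (s out)" using refl out_less by (simp add: fresh_def)
    ultimately show False using assms(2) by simp
  qed
next
  case (step q c q' c')
  from step.hyps(1) show ?case
  proof cases
    case (Add j d)
    have "\<not> alive v (if j \<in> {..<K} then 3 + 2 * q else 4 + 2 * q, w)"
      by (rule not_alive_Add[OF Add(3-5,2)])
        (use step.IH Add(1) step.prems fresh_in_cycle in auto)
    then show ?thesis using wf_nth[OF Add(3)] Add(4) by simp
  next
    case (Br j k k')
    have j: "j < K" using wf_nth[OF Br(3)] Br(4) by simp
    show ?thesis
    proof
      assume "alive v (3 + 2 * q, w)"
      then obtain l' w' where st: "step A v (3 + 2 * q, w) 0 (l', w')"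
        and al: "alive v (l', w')" by (metis alive_stepE surj_pair)
      from al have "l' \<noteq> 1" using sink_not_alive by auto
      with st step.prems(1) j have "w' = w" "l' = 3 + 2 * q'"
        unfolding step_iff Br_edges[OF Br(3,4)]
        by (auto simp: delay_def fresh_def reset_def Br(1))
      with al step.IH step.prems Br(2) show False by simp
    qed
  qed
qed

text \<open>As all new counter values stay below \<open>p\<close>, every step of the computation
  lifts to the automaton; the self-loop without delay then runs forever.\<close>

lemma alive_if_accepting:
  assumes "(\<lambda>x y. mstep prog x y \<and> (\<forall>i<K. real (snd y i) < p))\<^sup>*\<^sup>* (q, c) (length prog, s)"
    "s out = 0" "fresh c w"
  shows "alive v (3 + 2 * q, w)"
  using assms(1,3)
proof (induction arbitrary: w rule: converse_rtranclp_induct2)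
  case refl
  have "step A v (3 + 2 * length prog, w) 0 (3 + 2 * length prog, w)"
    unfolding step_iff accept_edges using refl assms(2) out_less
    by (intro exI[of _ "[Clk_Const (Suc out) EQ 0]"] exI[of _ "[]"] exI[of _ "0::real"])
      (auto simp: delay_def reset_def fresh_def)
  then show ?case by (rule alive_loop)
next
  case (step q c q' c')
  from step.hyps(1) have less: "\<forall>i<K. real (c' i) < p" and m: "mstep prog (q, c) (q', c')" by auto
  from m show ?case
  proof cases
    case (Add j d)
    have "alive v (if j \<in> {..<K} then 3 + 2 * q else 4 + 2 * q, w)"
    proof (rule alive_Add[OF Add(3-5,2)])
      show "\<forall>i\<in>{..<K}. w 0 + real (c' i) \<le> p" "w 0 \<le> p"
        using step.prems less p_pos by (auto simp: fresh_def intro: less_imp_le)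
    qed (use step.IH Add(1) step.prems less fresh_in_cycle in auto)
    then show ?thesis using wf_nth[OF Add(3)] Add(4) by simp
  next
    case (Br j k k')
    have j: "j < K" using wf_nth[OF Br(3)] Br(4) by simp
    let ?g = "[Clk_Const 0 EQ 0, Clk_Const (Suc j) (if c j = 0 then EQ else GT) 0]"
    have "step A v (3 + 2 * q, w) 0 (3 + 2 * q', w)"
      unfolding step_iff Br_edges[OF Br(3,4)] using step.prems j
      by (intro exI[of _ ?g] exI[of _ "[]"] exI[of _ "0::real"])
        (auto simp: delay_def reset_def fresh_def Br(1))
    moreover have "alive v (3 + 2 * q', w)" using step.IH step.prems Br(2) by simp
    ultimately show ?thesis by (rule alive_back)
  qed
qed

end

text \<open>A finite computation visits finitely many stores, and only \<open>K\<close> counters of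
  each are to be bounded.\<close>

lemma bounded_run:
  assumes "(mstep prog)\<^sup>*\<^sup>* x y"
  shows "\<exists>P::nat. \<forall>p\<ge>real P.
    (\<lambda>x y. mstep prog x y \<and> (\<forall>i<K. real (snd y i) < p))\<^sup>*\<^sup>* x y"
  using assms
proof induction
  case base
  show ?case by blast
next
  case (step y z)
  then obtain P where P: "\<And>p. p \<ge> real P \<Longrightarrow>
    (\<lambda>x y. mstep prog x y \<and> (\<forall>i<K. real (snd y i) < p))\<^sup>*\<^sup>* x y" by blast
  let ?Q = "P + Suc (\<Sum>i<K. snd z i)"
  have less: "snd z i < ?Q" if "i < K" for i
    using member_le_sum[of i "{..<K}" "snd z"] that by simp
  have "(\<lambda>x y. mstep prog x y \<and> (\<forall>i<K. real (snd y i) < p))\<^sup>*\<^sup>* x z" if p: "p \<ge> real ?Q" for p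
  proof (rule rtranclp.rtrancl_into_rtrancl[OF P])
    show "mstep prog y z \<and> (\<forall>i<K. real (snd z i) < p)"
      using step.hyps(2) less p by (meson of_nat_less_iff order.strict_trans2)
    show "real P \<le> p" using p by (meson le_add1 of_nat_le_iff order_trans)
  qed
  then show ?case by blast
qed

section \<open>Languages\<close>

context machine
begin

text \<open>The only edge with another letter wants clock \<open>0\<close> strictly between the two
  parameters.\<close>

lemma step_action:
  assumes "step A v s a s'" "v 0 = v 1"
  shows "a = 0"
proof -
  obtain l w l' w' where s: "s = (l, w)" "s' = (l', w')" by (metis surj_pair)
  from assms(1)[unfolded s step_iff] obtain g R d where
    e: "(l, g, a, R, l') \<in> set (edges A)" and g: "sat v (delay w d) g" by blast
  from e[unfolded edges_iff] show ?thesis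
  proof (elim disjE exE conjE)
    fix q assume "(l, g, a, R, l') = op_edge (q, prog ! q)"
    then show ?thesis by (cases "prog ! q") auto
  next
    fix q assume "(l, g, a, R, l') \<in> set (aux_edges K (q, prog ! q))"
    then show ?thesis by (cases "prog ! q") (auto simp: hold_edges_def)
  next
    assume "(l, g, a, R, l') \<in> set (base_edges N (length prog) out)"
    then show ?thesis using g assms(2) by (auto simp: base_edges_def)
  qed
qed

lemma step_source:
  assumes "step A v s a s'"
  shows "fst s < N" "fst s \<noteq> 1"
proof -
  obtain l w l' w' where s: "s = (l, w)" "s' = (l', w')" by (metis surj_pair)
  from assms[unfolded s step_iff] wf_machine_pta show "fst s < N"
    by (fastforce simp: s wf_pta_def)
  show "fst s \<noteq> 1" using assms sink_no_step by (metis prod.collapse)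
qed

text \<open>Leaving the infinite run for the dead end at any moment yields every nonempty finite
  word; the empty word is missing because the initial configuration can move.\<close>

lemma language_alive:
  assumes v: "v 0 = v 1" and alive: "alive v (init_config A)"
  shows "language A v = {Fin u | u. u \<noteq> [] \<and> set u \<subseteq> {0}} \<union> {Inf (\<lambda>_. 0)}"
proof
  have ex: "\<exists>a s. step A v (init_config A) a s"
    using alive by (blast elim: alive_stepE)
  have act: "step A v s a s' \<Longrightarrow> a = 0" for s a s' using step_action v by blast
  have "u \<noteq> [] \<and> set u \<subseteq> {0}" if "\<rho> 0 = init_config A"
    "\<forall>i < length u. step A v (\<rho> i) (u ! i) (\<rho> (Suc i))" "\<nexists>a s. step A v (\<rho> (length u)) a s" for u \<rho>
  proof
    show "u \<noteq> []" using ex that(1,3) by (metis list.size(3))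
    have "u ! i = 0" if i: "i < length u" for i
      using \<open>\<forall>i<length u. step A v (\<rho> i) (u ! i) (\<rho> (Suc i))\<close> i act by blast
    then show "set u \<subseteq> {0}" by (auto simp: in_set_conv_nth)
  qed
  moreover have "u = (\<lambda>_. 0)" if "\<forall>i. step A v (\<rho> i) (u i) (\<rho> (Suc i))" for u \<rho>
    using that act by blast
  ultimately show "language A v \<subseteq> {Fin u | u. u \<noteq> [] \<and> set u \<subseteq> {0}} \<union> {Inf (\<lambda>_. 0)}"
    unfolding language_def by blast
  from alive obtain \<rho> where \<rho>: "\<rho> 0 = init_config A" "\<And>i::nat. step A v (\<rho> i) 0 (\<rho> (Suc i))"
    by (auto simp: alive_def)
  have cfg: "is_config A v (\<rho> 0)" using N_large by (simp add: \<rho>(1) init_config_def is_config_def)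
  have "Fin u \<in> language A v" if u: "u \<noteq> []" "set u \<subseteq> {0}" for u
  proof -
    from u(1) obtain k where k: "length u = Suc k" by (cases u) auto
    have u0: "u ! i = 0" if "i < length u" for i using u(2) that by (auto simp: subset_iff)
    \<comment> \<open>The last letter of \<open>u\<close> is spent on the move into the dead end,
      after \<open>k\<close> steps of the infinite run.\<close>
    let ?\<rho> = "\<lambda>i. if i \<le> k then \<rho> i else (1, snd (\<rho> k))"
    have "step A v (\<rho> k) 0 (1, snd (\<rho> k))"
      using step_sink step_source[OF \<rho>(2)[of k]] by (metis prod.collapse)
    then have "\<forall>i<length u. step A v (?\<rho> i) (u ! i) (?\<rho> (Suc i))"
      using \<rho>(2) u0 by (auto simp: k less_Suc_eq_le Suc_le_eq dest: le_neq_implies_less)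
    moreover have "\<nexists>a s. step A v (?\<rho> (length u)) a s" using k sink_no_step by simp
    ultimately show ?thesis unfolding language_def using \<rho>(1) cfg
      by (intro UnI1 CollectI exI[of _ u] conjI exI[of _ ?\<rho>]) auto
  qed
  moreover have "Inf (\<lambda>_. 0) \<in> language A v" unfolding language_def using \<rho> cfg by blast
  ultimately show "{Fin u | u. u \<noteq> [] \<and> set u \<subseteq> {0}} \<union> {Inf (\<lambda>_. 0)} \<subseteq> language A v" by blast
qed

text \<open>A preserving valuation cannot have lower below upper, by the letter \<open>1\<close>,
  nor lower above upper, by the infinite word. So both parameters equal some \<open>p > 0\<close>,
  and the infinite word hinges on the output counter.\<close>

lemma language_preserved_iff:
  assumes run: "(mstep prog)\<^sup>*\<^sup>* (0, \<lambda>_. 0) (length prog, s)"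
  shows "language_preserved A (\<lambda>_. 0) \<longleftrightarrow> s out = 0"
proof -
  let ?T = "{Fin u | u. u \<noteq> [] \<and> set u \<subseteq> {0}} \<union> {Inf (\<lambda>_. 0)}"
  let ?zero = "\<lambda>_. 0 :: real"
  have "step A (\<lambda>_. 0) (2, ?zero) 0 (2, ?zero)" "step A (\<lambda>_. 0) (0, ?zero) 0 (2, ?zero)"
    unfolding step_iff init_edges
    by (intro exI[of _ "[]"] exI[of _ "0::real"];
        auto simp: edges_low base_edges_def delay_def reset_def)
      (intro exI[of _ "[Clk_Par 0 GE 0 0, Clk_Const 0 LE 0]"] exI[of _ "[]"] exI[of _ "0::real"];
        auto simp: delay_def reset_def)
  then have "alive (\<lambda>_. 0) (init_config A)"
    unfolding init_config_def using alive_loop alive_back by simp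
  then have L0: "language A (\<lambda>_. 0) = ?T" by (intro language_alive) simp_all
  show ?thesis
  proof
    assume out: "s out = 0"
    from bounded_run[OF run] obtain P :: nat where P: "\<And>p. p \<ge> real P \<Longrightarrow>
      (\<lambda>x y. mstep prog x y \<and> (\<forall>i<K. real (snd y i) < p))\<^sup>*\<^sup>* (0, \<lambda>_. 0) (length prog, s)"
      by blast
    \<comment> \<open>\<open>P\<close> bounds the counters of the computation, and the successor
      makes the parameters positive, hence different from the reference valuation.\<close>
    let ?v = "\<lambda>_::nat. of_nat (Suc P) :: rat"
    interpret machine_valuation N K out prog ?v "real (Suc P)"
      by unfold_locales (simp_all del: of_nat_Suc)
    let ?w = "reset {0..<N} (delay ?zero (real (Suc P)))"
    have "alive ?v (3 + 2 * 0, ?w)"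
      by (rule alive_if_accepting[OF P out]) (use K_less in \<open>auto simp: fresh_def reset_def\<close>)
    moreover have "step A ?v (0, ?zero) 0 (3, ?w)"
      unfolding step_iff init_edges
      by (intro exI[of _ "eq_par 0 0"] exI[of _ "[0..<N]"] exI[of _ "real (Suc P)"])
        (simp add: delay_def v_simps del: of_nat_Suc)
    ultimately have "alive ?v (init_config A)"
      unfolding init_config_def using alive_back by simp
    then have "language A ?v = language A (\<lambda>_. 0)"
      unfolding L0 by (intro language_alive) simp_all
    then show "language_preserved A (\<lambda>_. 0)"
      unfolding language_preserved_def valuation_def by (intro exI[of _ ?v]) auto
  next
    assume "language_preserved A (\<lambda>_. 0)"
    then obtain v where v: "valuation A v" "v 0 \<noteq> 0 \<or> v 1 \<noteq> 0" and L: "language A v = ?T"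
      by (auto simp: language_preserved_def L0)
    let ?l = "real_of_rat (v 0)" and ?u = "real_of_rat (v 1)"
    have nonneg: "0 \<le> ?l" "0 \<le> ?u" using v(1) by (auto simp: valuation_def)
    have ul: "?u \<le> ?l"
    proof (rule ccontr)
      assume "\<not> ?u \<le> ?l"
      let ?w = "delay ?zero ((?l + ?u) / 2)"
      have "step A v (0, ?zero) 1 (1, ?w)"
        unfolding step_iff init_edges using nonneg \<open>\<not> ?u \<le> ?l\<close>
        by (intro exI[of _ "[Clk_Par 0 GT 0 0, Clk_Par 0 LT 1 0]"] exI[of _ "[]"]
            exI[of _ "(?l + ?u) / 2"]) (auto simp: delay_def reset_def)
      then have "Fin [1] \<in> language A v"
        unfolding language_def using sink_no_step N_large
        by (intro UnI1 CollectI exI[of _ "[1]"] conjI exI[of _ "case_nat (0, ?zero) (\<lambda>_. (1, ?w))"])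
          (auto simp: init_config_def is_config_def)
      with L show False by auto
    qed
    have "Inf (\<lambda>_. 0) \<in> language A v" using L by simp
    then have "alive v (0, ?zero)"
      unfolding language_def alive_def by (auto simp: init_config_def fun_eq_iff)
    then obtain l' w' where st: "step A v (0, ?zero) 0 (l', w')" and al: "alive v (l', w')"
      by (metis alive_stepE surj_pair)
    from al have "l' \<noteq> 1" using sink_not_alive by auto
    with st obtain t where "l' = 2 \<and> ?l \<le> 0 \<or> l' = 3 \<and> ?l \<le> ?u \<and> w' = reset {0..<N} (delay ?zero t)"
      unfolding step_iff init_edges by (auto simp: delay_def)
    \<comment> \<open>If the lower-bound parameter were zero, \<open>ul\<close> would make the other
      one zero too, which is the reference valuation.\<close>
    moreover have "\<not> ?l \<le> 0" using ul nonneg v(2) by auto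
    ultimately have 3: "l' = 3" "?l = ?u" "w' = reset {0..<N} (delay ?zero t)" "0 < ?l"
      using ul by auto
    interpret machine_valuation N K out prog v ?l
      by unfold_locales (use 3 in auto)
    show "s out = 0"
    proof (rule ccontr)
      assume out: "s out \<noteq> 0"
      have "\<not> alive v (3 + 2 * 0, w')"
        by (rule not_alive_if_rejecting[OF run out])
          (use K_less 3 in \<open>auto simp: fresh_def reset_def\<close>)
      with al 3(1) show False by simp
    qed
  qed
qed

end

section \<open>Self-reference\<close>

definition computable :: "nat \<Rightarrow> (nat list \<Rightarrow> nat) \<Rightarrow> bool" where
  "computable n h \<longleftrightarrow> (\<exists>f. \<forall>xs. length xs = n \<longrightarrow> computes f xs (h xs))"

lemma computable_Comp:
  assumes "computable (length hs) g" "\<forall>h\<in>set hs. computable n h"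
  shows "computable n (\<lambda>xs. g (map (\<lambda>h. h xs) hs))"
proof -
  from assms(1) obtain f where f: "\<forall>xs. length xs = length hs \<longrightarrow> computes f xs (g xs)"
    by (auto simp: computable_def)
  from assms(2) obtain F where F: "\<forall>h\<in>set hs. \<forall>xs. length xs = n \<longrightarrow> computes (F h) xs (h xs)"
    unfolding computable_def by metis
  have "computes (Comp f (map F hs)) xs (g (map (\<lambda>h. h xs) hs))" if "length xs = n" for xs
    by (rule computes.comp[where ys = "map (\<lambda>h. h xs) hs"])
      (use F f that in \<open>auto simp: list_all2_conv_all_nth\<close>)
  then show ?thesis by (auto simp: computable_def)
qed

lemma computable_nth: "i < n \<Longrightarrow> computable n (\<lambda>xs. xs ! i)"
  unfolding computable_def by (auto intro: computes.proj)

lemma computable_cong: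
  "computable n g \<Longrightarrow> (\<And>xs. length xs = n \<Longrightarrow> g xs = h xs) \<Longrightarrow> computable n h"
  unfolding computable_def by metis

lemma computable_unary:
  "computable 1 (\<lambda>xs. g (xs ! 0)) \<Longrightarrow> computable n h \<Longrightarrow> computable n (\<lambda>xs. g (h xs))"
  using computable_Comp[of "[h]" "\<lambda>xs. g (xs ! 0)" n] by simp

lemma computable_binary:
  "computable 2 (\<lambda>xs. g (xs ! 0) (xs ! 1)) \<Longrightarrow> computable n h \<Longrightarrow> computable n h' \<Longrightarrow>
     computable n (\<lambda>xs. g (h xs) (h' xs))"
  using computable_Comp[of "[h, h']" "\<lambda>xs. g (xs ! 0) (xs ! 1)" n] by (simp add: numeral_2_eq_2)

lemma computable_Suc:
  assumes "computable n h"
  shows "computable n (\<lambda>xs. Suc (h xs))"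
proof (rule computable_unary[OF _ assms])
  have "computes Succ xs (Suc (xs ! 0))" if "length xs = 1" for xs
    using that by (cases xs) (auto intro: computes.succ)
  then show "computable 1 (\<lambda>xs. Suc (xs ! 0))" unfolding computable_def by blast
qed

lemma computable_const: "computable n (\<lambda>_. k)"
proof (induction k)
  case 0
  show ?case unfolding computable_def by (auto intro: computes.zero)
qed (rule computable_Suc)

lemma computable_Prim_Rec:
  assumes "computable n g" "computable (Suc (Suc n)) h"
  shows "computable (Suc n) (\<lambda>xs. rec_nat (g (tl xs)) (\<lambda>k r. h (k # r # tl xs)) (xs ! 0))"
proof -
  from assms obtain F H where F: "\<And>xs. length xs = n \<Longrightarrow> computes F xs (g xs)"
    and H: "\<And>xs. length xs = Suc (Suc n) \<Longrightarrow> computes H xs (h xs)"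
    by (auto simp: computable_def)
  have "computes (Prim_Rec F H) (m # ys) (rec_nat (g ys) (\<lambda>k r. h (k # r # ys)) m)"
    if "length ys = n" for m ys
  proof (induction m)
    case 0
    show ?case using F[OF that] by (auto intro: computes.prim_rec_0)
  next
    case (Suc m)
    then show ?case using H that by (auto intro: computes.prim_rec_Suc)
  qed
  then have "computes (Prim_Rec F H) xs (rec_nat (g (tl xs)) (\<lambda>k r. h (k # r # tl xs)) (xs ! 0))"
    if "length xs = Suc n" for xs using that by (cases xs) auto
  then show ?thesis unfolding computable_def by blast
qed

lemma computable_add:
  assumes "computable n g" "computable n h"
  shows "computable n (\<lambda>xs. g xs + h xs)"
proof (rule computable_binary[OF _ assms])
  have rec: "rec_nat b (\<lambda>k r. Suc r) a = a + b" for a b :: nat by (induction a) auto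
  have "computable 1 (\<lambda>xs. xs ! 0)" "computable (Suc (Suc 1)) (\<lambda>xs. Suc (xs ! 1))"
    by (intro computable_Suc computable_nth; simp)+
  from computable_Prim_Rec[OF this] show "computable 2 (\<lambda>xs. xs ! 0 + xs ! 1)"
    unfolding Suc_1 by (rule computable_cong) (simp add: rec nth_tl)
qed

lemma computable_rec:
  assumes "computable 2 (\<lambda>xs. h (xs ! 0) (xs ! 1))" "computable n g"
  shows "computable n (\<lambda>xs. rec_nat k h (g xs))"
  using computable_unary[OF _ assms(2), of "rec_nat k h"]
    computable_Prim_Rec[OF computable_const[of 0 k], of "\<lambda>xs. h (xs ! 0) (xs ! 1)"] assms(1)
  by (simp add: numeral_2_eq_2)

lemma computable_pred:
  assumes "computable n h"
  shows "computable n (\<lambda>xs. h xs - 1)"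
proof -
  have "rec_nat 0 (\<lambda>k r. k) a = a - 1" for a :: nat by (induction a) auto
  with computable_rec[of "\<lambda>k r. k", OF computable_nth assms, of 0] show ?thesis by simp
qed

lemma computable_triangle:
  assumes "computable n h"
  shows "computable n (\<lambda>xs. triangle (h xs))"
proof -
  have "rec_nat 0 (\<lambda>k r. r + Suc k) a = triangle a" for a :: nat by (induction a) auto
  with computable_rec[of "\<lambda>k r. r + Suc k", OF _ assms, of 0] show ?thesis
    by (simp add: computable_add computable_Suc computable_nth del: add_Suc_right)
qed

text \<open>The pairing function is \<open>triangle (m + n) + m\<close>.\<close>

lemma computable_prod_encode:
  "computable n g \<Longrightarrow> computable n h \<Longrightarrow> computable n (\<lambda>xs. prod_encode (g xs, h xs))"
  unfolding prod_encode_def by (simp add: computable_add computable_triangle)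

text \<open>The guard of a loading edge contains the constant \<open>- int x\<close>. Truncated
  subtraction gives the right code 0 for \<open>x = 0\<close>.\<close>

lemma int_encode_uminus: "int_encode (- int a) = a + a - 1"
  by (cases a) (auto simp: int_encode_def sum_encode_def)

text \<open>
  The program loads three numbers into the counters \<open>0\<close>, \<open>1\<close>, \<open>2\<close> before running \<open>code\<close>. They
  will be the codes of all those parts of its own automaton that do not depend on them.
\<close>

definition loader :: "nat \<Rightarrow> nat \<Rightarrow> nat \<Rightarrow> instr list" where
  "loader x y z = [Add 0 (int x), Add 1 (int y), Add 2 (int z)]"

definition load_code :: "nat \<Rightarrow> nat \<Rightarrow> nat" where
  "load_code q x = edge_code (op_edge (q, Add q (int x)))"

text \<open>The instance code as a function of the codes of the locations (and clocks), the
  invariants and the remaining edges. The edge list is spelled out with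
  \<open>Suc (prod_encode ...)\<close>, the code of a cons, because its tail is given only by its
  code \<open>xs ! 2\<close>.\<close>

definition template :: "nat list \<Rightarrow> nat" where
  "template xs = prod_encode
     (list_encode [list_encode [0, 1], xs ! 0, 0, xs ! 0, list_encode [0, 1], xs ! 1,
        Suc (prod_encode (load_code 0 (xs ! 0), Suc (prod_encode (load_code 1 (xs ! 1),
          Suc (prod_encode (load_code 2 (xs ! 2), xs ! 2))))))],
      list_encode [rat_code 0, rat_code 0])"

lemma computable_load_code:
  assumes "computable n h"
  shows "computable n (\<lambda>xs. load_code q (h xs))"
proof -
  show ?thesis
    unfolding load_code_def op_edge.simps edge_code.simps constr_code_def eq_par_def list.map
      atom_code.simps list_encode.simps int_encode_uminus
    by (intro computable_const computable_Suc computable_prod_encode computable_pred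
        computable_add assms)
qed

lemma computable_template: "computable 3 template"
proof -
  have nth: "computable 3 (\<lambda>xs. xs ! 0)" "computable 3 (\<lambda>xs. xs ! 1)" "computable 3 (\<lambda>xs. xs ! 2)"
    by (simp_all add: computable_nth)
  show ?thesis
    unfolding template_def list_encode.simps
    by (intro computable_const computable_Suc computable_prod_encode computable_load_code nth)
qed

text \<open>There is no circularity: \<open>x\<close>, \<open>y\<close>, \<open>z\<close> describe
  only parts that are the same for all loaded numbers, so \<open>z\<close> may be formed with a
  loader of zeros. The edges containing the numbers are supplied by \<open>template\<close>.\<close>

lemma instance_code_machine:
  fixes N K :: nat and code :: "instr list"
  defines "x \<equiv> list_encode [0..<N]" and "y \<equiv> list_encode (map (\<lambda>_. constr_code []) [0..<N])"
    and "z \<equiv> list_encode (map edge_code (map op_edge (enumerate 3 code) @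
      concat (map (aux_edges K) (enumerate 0 (loader 0 0 0 @ code))) @ base_edges N (3 + length code) 3))"
  shows "instance_code (machine_pta N K 3 (loader x y z @ code), \<lambda>_. 0) = template [x, y, z]"
proof -
  have "concat (map (aux_edges K) (enumerate 0 (loader x y z @ code)))
      = concat (map (aux_edges K) (enumerate 0 (loader 0 0 0 @ code)))"
    by (simp add: loader_def)
  then have "edges (machine_pta N K 3 (loader x y z @ code)) =
     op_edge (0, Add 0 (int x)) # op_edge (1, Add 1 (int y)) # op_edge (2, Add 2 (int z)) #
     map op_edge (enumerate 3 code) @
      concat (map (aux_edges K) (enumerate 0 (loader 0 0 0 @ code))) @ base_edges N (3 + length code) 3"
    unfolding machine_pta_def by (simp add: loader_def numeral_2_eq_2 numeral_3_eq_3)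
  then have "list_encode (map edge_code (edges (machine_pta N K 3 (loader x y z @ code)))) =
     Suc (prod_encode (load_code 0 x, Suc (prod_encode (load_code 1 y, Suc (prod_encode (load_code 2 z, z))))))"
    unfolding z_def load_code_def by (simp del: op_edge.simps edge_code.simps)
  then show ?thesis
    unfolding instance_code_def pta_code_def template_def
    by (simp add: machine_pta_def x_def y_def del: list_encode.simps)
qed

lemma loader_run:
  assumes "prog = loader x y z @ code"
  shows "(mstep prog)\<^sup>*\<^sup>* (0, \<lambda>_. 0) (3, (\<lambda>_. 0)(0 := x, 1 := y, 2 := z))"
proof -
  have len: "0 < length prog" "1 < length prog" "2 < length prog"
    and nth: "prog ! 0 = Add 0 (int x)" "prog ! 1 = Add 1 (int y)" "prog ! 2 = Add 2 (int z)"
    by (simp_all add: assms loader_def)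
  have "mstep prog (0, \<lambda>_. 0) (1, (\<lambda>_. 0)(0 := x))"
    using mstep.Add[OF len(1) nth(1), of "\<lambda>_. 0"] by simp
  moreover have "mstep prog (1, (\<lambda>_. 0)(0 := x)) (2, (\<lambda>_. 0)(0 := x, 1 := y))"
    using mstep.Add[OF len(2) nth(2), of "(\<lambda>_. 0)(0 := x)"] by (simp add: numeral_2_eq_2)
  moreover have "mstep prog (2, (\<lambda>_. 0)(0 := x, 1 := y)) (3, (\<lambda>_. 0)(0 := x, 1 := y, 2 := z))"
    using mstep.Add[OF len(3) nth(3), of "(\<lambda>_. 0)(0 := x, 1 := y)"] by (simp add: numeral_3_eq_3)
  ultimately show ?thesis by (meson converse_rtranclp_into_rtranclp rtranclp.rtrancl_refl)
qed

fun instr_bound :: "instr \<Rightarrow> nat" where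
  "instr_bound (Add j d) = j"
| "instr_bound (Br j k k') = j + k + k'"

lemma wf_instr_mono: "instr_bound i \<le> M \<Longrightarrow> M < K \<Longrightarrow> 3 + 2 * M < N \<Longrightarrow> wf_instr N K i"
  by (cases i) auto

theorem theorem5p9:
  shows "\<not> decidable instance_code lu_instances {(A, v). language_preserved A v}"
proof
  assume "decidable instance_code lu_instances {(A, v). language_preserved A v}"
  then obtain f where f: "\<And>i. i \<in> lu_instances \<Longrightarrow>
      computes f [instance_code i] (if i \<in> {(A, v). language_preserved A v} then 1 else 0)"
    unfolding decidable_def by blast
  from computable_template obtain t where t: "\<And>xs. length xs = 3 \<Longrightarrow> computes t xs (template xs)"
    by (auto simp: computable_def)
  \<comment> \<open>\<open>t\<close> rebuilds the instance code from the registers 0 to 2 and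
    \<open>f\<close> decides it. The answer goes to register 3, the output counter, and scratch
    space starts at 4. Assembly starts at address 3, behind the three loading instructions.\<close>
  define code where "code = assemble 3 (compile (Comp f [t]) [0, 1, 2] 3 4)"
  \<comment> \<open>\<open>M\<close> bounds all counters and jump targets in \<open>code\<close>;
    the summands 4 and 20 leave room for the counters 0 to 3, the loader and the special
    locations.\<close>
  define M where "M = (\<Sum>i\<leftarrow>code. instr_bound i)"
  define K where "K = M + 4"
  define N where "N = 2 * M + 2 * length code + 20"
  define x y z where xyz: "x = list_encode [0..<N]" "y = list_encode (map (\<lambda>_. constr_code []) [0..<N])"
    "z = list_encode (map edge_code (map op_edge (enumerate 3 code) @
      concat (map (aux_edges K) (enumerate 0 (loader 0 0 0 @ code))) @ base_edges N (3 + length code) 3))"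
  let ?prog = "loader x y z @ code"
  let ?A = "machine_pta N K 3 ?prog"
  have "instr_bound i \<le> M" if "i \<in> set code" for i
    unfolding M_def using that by (intro member_le_sum_list) auto
  then have "\<forall>i\<in>set ?prog. wf_instr N K i"
    by (auto simp: K_def N_def loader_def intro!: wf_instr_mono[of _ M])
  then interpret machine N K 3 ?prog
    by unfold_locales (auto simp: K_def N_def loader_def)
  have "(?A, \<lambda>_. 0) \<in> lu_instances"
    unfolding lu_instances_def using wf_machine_pta lu_machine_pta by (force simp: valuation_def)
  from f[OF this] have "computes f [template [x, y, z]] (if language_preserved ?A (\<lambda>_. 0) then 1 else 0)"
    by (simp only: instance_code_machine[of N K code, folded xyz] mem_Collect_eq case_prod_conv)
  with t[of "[x, y, z]"]
  have comp: "computes (Comp f [t]) [x, y, z] (if language_preserved ?A (\<lambda>_. 0) then 1 else 0)"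
    by (intro computes.comp[where ys = "[template [x, y, z]]"]) auto
  let ?s = "(\<lambda>_. 0)(0 := x, 1 := y, 2 := z)"
  let ?s' = "?s(3 := if language_preserved ?A (\<lambda>_. 0) then 1 else 0)"
  have len: "length (loader x y z) = 3" by (simp add: loader_def)
  have "bigstep (compile (Comp f [t]) [0, 1, 2] 3 4) ?s ?s'"
    by (rule implementsD[OF compile_correct comp]) auto
  from assemble_correct[OF this, of ?prog "loader x y z" "[]"]
  have "(mstep ?prog)\<^sup>*\<^sup>* (3, ?s) (length ?prog, ?s')"
    by (simp only: len length_append code_def append_Nil2)
  with loader_run[OF refl] have "(mstep ?prog)\<^sup>*\<^sup>* (0, \<lambda>_. 0) (length ?prog, ?s')"
    by (rule rtranclp_trans)
  \<comment> \<open>The language is preserved iff the output counter ends at 0, but the decider has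
    put 1 there exactly if the language is preserved.\<close>
  from language_preserved_iff[OF this] show False by (simp split: if_splits)
qed

end
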